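(* Let $k$ be a field of characteristic zero, $n\in\mathbb{N}$, and let $(\boldsymbol{\Delta},\chi,E)$ be an arithmetic root system, where $E=\{e_1,\ldots,e_n\}$ is an ordered basis of $\mathbb{Z}^n$ and $\chi$ is a bicharacter on $\mathbb{Z}^n$ with values in $k\setminus\{0\}$. Then $\boldsymbol{\Delta}=\boldsymbol{\Delta}^+_E\cup-\boldsymbol{\Delta}^+_E$, where $$\boldsymbol{\Delta}^+_E=\Big\{\alpha\in\boldsymbol{\Delta}\ \Big|\ \alpha=\sum_{i=1}^n m_ie_i,\ m_i\in\mathbb{N}_0\text{ for all }i\Big\}.$$
   Context: $\mathbb{N}_0$ and $\mathbb{N}$ denote the natural numbers including, respectively not including, zero. Let $G$ be an abelian group (written multiplicatively; here $G=k\setminus\{0\}$). A bicharacter $\chi:\mathbb{Z}^n\times\mathbb{Z}^n\to G$ is a map with $\chi(0,e)=\chi(e,0)=1$, $\chi(e'+e'',e)=\chi(e',e)\chi(e'',e)$, $\chi(e,e'+e'')=\chi(e,e')\chi(e,e'')$ for all $e,e',e''$. For an ordered basis $E=\{e_1,\ldots,e_n\}$ of $\mathbb{Z}^n$ and $i\in\{1,\ldots,n\}$, suppose that for all $j\ne i$ the number $$m_{ij}:=\min\{m\in\mathbb{N}_0 \mid \text{either } \chi(e_i,e_i)^m\chi(e_i,e_j)\chi(e_j,e_i)=1 \text{ or } (\chi(e_i,e_i)^{m+1}=1,\ \chi(e_i,e_i)\neq 1)\}$$ exists (i.e. the set is nonempty). Then one says $s_{i,E}$ is (well-)defined, and $s_{i,E}\in\mathrm{Aut}(\mathbb{Z}^n)$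 is the linear map with $s_{i,E}(e_i)=-e_i$ and $s_{i,E}(e_j)=e_j+m_{ij}e_i$ for $j\ne i$. Let $\widetilde{W}$ be the Brandt groupoid of all pairs $(T,B)$ with $T\in\mathrm{Aut}(\mathbb{Z}^n)$ and $B$ an ordered basis of $\mathbb{Z}^n$, where $(T_1,B_1)\circ(T_2,B_2)$ is defined, and equal to $(T_1T_2,B_2)$, if and only if $T_2(B_2)=B_1$. For an ordered basis $E$, $W_{\chi,E}$ is the smallest Brandt subgroupoid of $\widetilde{W}$ that contains $(\mathrm{id},E)$ and such that, whenever $(\mathrm{id},E')\in W_{\chi,E}$ and $s_{i,E'}$ is defined, then $(s_{i,E'},E')$ and $(\mathrm{id},s_{i,E'}(E'))$ lie in $W_{\chi,E}$. The triple $(\boldsymbol{\Delta},\chi,E)$ is called an arithmetic root system if $W_{\chi,E}$ is finite, for every ordered basis $E'$ with $(\mathrm{id},E')\in W_{\chi,E}$ the maps $s_{i,E'}$ are defined for all $i\in\{1,\ldots,n\}$, and $\boldsymbol{\Delta}=\bigcup\{E' \mid (\mathrm{id},E')\in W_{\chi,E}\}\subset\mathbb{Z}^n$ (union of sets, every element having multiplicity one). *)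

theory Defs
  imports "HOL-Analysis.Finite_Cartesian_Product"
begin

text \<open>
  The lattice of rank \<open>n\<close> is the type \<^typ>\<open>int ^ 'n\<close> with \<open>n = CARD('n) \<ge> 1\<close>. Ordered
  families \<open>(e\<^sub>1, \<dots>, e\<^sub>n)\<close> in it are functions of type \<open>'n \<Rightarrow> int ^ 'n\<close>.
\<close>

interpretation int_vec: module "(*s) :: int \<Rightarrow> int ^ 'n \<Rightarrow> int ^ 'n"
  by unfold_locales (simp_all add: vec_eq_iff algebra_simps)

definition ordered_basis :: "('n \<Rightarrow> int ^ 'n) \<Rightarrow> bool" where
  "ordered_basis B \<longleftrightarrow>
     inj B \<and> int_vec.independent (range B) \<and> int_vec.span (range B) = UNIV"

definition lattice_aut :: "(int ^ 'n \<Rightarrow> int ^ 'n) \<Rightarrow> bool" where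
  "lattice_aut T \<longleftrightarrow> module_hom (*s) (*s) T \<and> bij T"

definition bicharacter :: "(int ^ 'n \<Rightarrow> int ^ 'n \<Rightarrow> 'k::field) \<Rightarrow> bool" where
  "bicharacter chi \<longleftrightarrow>
     (\<forall>e e'. chi e e' \<noteq> 0) \<and>
     (\<forall>e. chi 0 e = 1 \<and> chi e 0 = 1) \<and>
     (\<forall>e e' e''. chi (e' + e'') e = chi e' e * chi e'' e) \<and>
     (\<forall>e e' e''. chi e (e' + e'') = chi e e' * chi e e'')"


definition refl_coeff_cond ::
  "(int ^ 'n \<Rightarrow> int ^ 'n \<Rightarrow> 'k::field) \<Rightarrow> ('n \<Rightarrow> int ^ 'n) \<Rightarrow> 'n \<Rightarrow> 'n \<Rightarrow> nat \<Rightarrow> bool" where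
  "refl_coeff_cond chi E i j m \<longleftrightarrow>
     chi (E i) (E i) ^ m * chi (E i) (E j) * chi (E j) (E i) = 1 \<or>
     (chi (E i) (E i) ^ (m + 1) = 1 \<and> chi (E i) (E i) \<noteq> 1)"

definition refl_coeff ::
  "(int ^ 'n \<Rightarrow> int ^ 'n \<Rightarrow> 'k::field) \<Rightarrow> ('n \<Rightarrow> int ^ 'n) \<Rightarrow> 'n \<Rightarrow> 'n \<Rightarrow> nat" where
  "refl_coeff chi E i j = (LEAST m. refl_coeff_cond chi E i j m)"

definition reflection_defined ::
  "(int ^ 'n \<Rightarrow> int ^ 'n \<Rightarrow> 'k::field) \<Rightarrow> ('n \<Rightarrow> int ^ 'n) \<Rightarrow> 'n \<Rightarrow> bool" where
  "reflection_defined chi E i \<longleftrightarrow> (\<forall>j. j \<noteq> i \<longrightarrow> (\<exists>m. refl_coeff_cond chi E i j m))"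

definition reflection ::
  "(int ^ 'n \<Rightarrow> int ^ 'n \<Rightarrow> 'k::field) \<Rightarrow> ('n \<Rightarrow> int ^ 'n) \<Rightarrow> 'n \<Rightarrow> int ^ 'n \<Rightarrow> int ^ 'n" where
  "reflection chi E i = (THE T. module_hom (*s) (*s) T \<and> T (E i) = - E i \<and>
     (\<forall>j. j \<noteq> i \<longrightarrow> T (E j) = E j + int (refl_coeff chi E i j) *s E i))"


text \<open>
  The axioms of Clifford and Preston (The Algebraic Theory of Semigroups, Section 3.3) for a set
  \<open>S\<close> with a partial operation: cancellation, associativity, existence and uniqueness of left
  units, right units and inverses, and connectedness. The operation may be given on a larger
  type; it is read as restricted to \<open>S\<close>, which is required to be closed under it.
\<close>

definition brandt_groupoid :: "'a set \<Rightarrow> ('a \<Rightarrow> 'a \<Rightarrow> 'a option) \<Rightarrow> bool" where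
  "brandt_groupoid S f \<longleftrightarrow>
     S \<noteq> {} \<and>
     (\<forall>a\<in>S. \<forall>b\<in>S. \<forall>c. f a b = Some c \<longrightarrow> c \<in> S) \<and>
     (\<forall>a\<in>S. \<forall>b\<in>S. \<forall>b'\<in>S. f a b \<noteq> None \<and> f a b = f a b' \<longrightarrow> b = b') \<and>
     (\<forall>a\<in>S. \<forall>a'\<in>S. \<forall>b\<in>S. f a b \<noteq> None \<and> f a b = f a' b \<longrightarrow> a = a') \<and>
     (\<forall>a\<in>S. \<forall>b\<in>S. \<forall>c\<in>S. \<forall>x y. f a b = Some x \<and> f b c = Some y \<longrightarrow>
        f x c \<noteq> None \<and> f x c = f a y) \<and>
     (\<forall>a\<in>S. \<forall>b\<in>S. \<forall>c\<in>S. \<forall>x z. f a b = Some x \<and> f x c = Some z \<longrightarrow>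
        (\<exists>y. f b c = Some y \<and> f a y = Some z)) \<and>
     (\<forall>a\<in>S. \<forall>b\<in>S. \<forall>c\<in>S. \<forall>y z. f b c = Some y \<and> f a y = Some z \<longrightarrow>
        (\<exists>x. f a b = Some x \<and> f x c = Some z)) \<and>
     (\<forall>a\<in>S. \<exists>!e. e \<in> S \<and> f e a = Some a) \<and>
     (\<forall>a\<in>S. \<exists>!e. e \<in> S \<and> f a e = Some a) \<and>
     (\<forall>a\<in>S. \<forall>e\<in>S. f a e = Some a \<longrightarrow> (\<exists>!a'. a' \<in> S \<and> f a' a = Some e)) \<and>
     (\<forall>e\<in>S. \<forall>e'\<in>S. f e e = Some e \<and> f e' e' = Some e' \<longrightarrow>
        (\<exists>a\<in>S. f e a = Some a \<and> f a e' = Some a))"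

definition brandt_subgroupoid :: "'a set \<Rightarrow> 'a set \<Rightarrow> ('a \<Rightarrow> 'a \<Rightarrow> 'a option) \<Rightarrow> bool" where
  "brandt_subgroupoid U S f \<longleftrightarrow> U \<subseteq> S \<and> brandt_groupoid U f"


type_synonym 'n arrow = "(int ^ 'n \<Rightarrow> int ^ 'n) \<times> ('n \<Rightarrow> int ^ 'n)"

definition full_groupoid :: "'n::finite arrow set" where
  "full_groupoid = {(T, B). lattice_aut T \<and> ordered_basis B}"

definition arrow_comp :: "'n::finite arrow \<Rightarrow> 'n::finite arrow \<Rightarrow> 'n::finite arrow option" where
  "arrow_comp x y = (case (x, y) of ((T\<^sub>1, B\<^sub>1), (T\<^sub>2, B\<^sub>2)) \<Rightarrow>
     if T\<^sub>2 \<circ> B\<^sub>2 = B\<^sub>1 then Some (T\<^sub>1 \<circ> T\<^sub>2, B\<^sub>2) else None)"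

definition weyl_closed ::
  "(int ^ 'n \<Rightarrow> int ^ 'n \<Rightarrow> 'k::field) \<Rightarrow> ('n \<Rightarrow> int ^ 'n) \<Rightarrow> 'n::finite arrow set \<Rightarrow> bool" where
  "weyl_closed chi E U \<longleftrightarrow>
     brandt_subgroupoid U full_groupoid arrow_comp \<and>
     (id, E) \<in> U \<and>
     (\<forall>E' i. (id, E') \<in> U \<and> reflection_defined chi E' i \<longrightarrow>
        (reflection chi E' i, E') \<in> U \<and> (id, reflection chi E' i \<circ> E') \<in> U)"

text \<open>
  The smallest such subgroupoid. Connected subgroupoids are not closed under intersection in
  general; the lemma \<open>weyl_groupoid_least\<close> below shows that here the intersection is again one.
\<close>

definition weyl_groupoid ::
  "(int ^ 'n \<Rightarrow> int ^ 'n \<Rightarrow> 'k::field) \<Rightarrow> ('n \<Rightarrow> int ^ 'n) \<Rightarrow> 'n::finite arrow set" where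
  "weyl_groupoid chi E = \<Inter> {U. weyl_closed chi E U}"

definition arithmetic_root_system ::
  "(int ^ 'n) set \<Rightarrow> (int ^ 'n \<Rightarrow> int ^ 'n \<Rightarrow> 'k::field) \<Rightarrow> ('n \<Rightarrow> int ^ 'n) \<Rightarrow> bool" where
  "arithmetic_root_system \<Delta> chi E \<longleftrightarrow>
     finite (weyl_groupoid chi E) \<and>
     (\<forall>E'. (id, E') \<in> weyl_groupoid chi E \<longrightarrow> (\<forall>i. reflection_defined chi E' i)) \<and>
     \<Delta> = (\<Union>E' \<in> {E'. (id, E') \<in> weyl_groupoid chi E}. range E')"

definition positive_roots :: "(int ^ 'n) set \<Rightarrow> ('n \<Rightarrow> int ^ 'n) \<Rightarrow> (int ^ 'n) set" where
  "positive_roots \<Delta> E = {\<alpha> \<in> \<Delta>. \<exists>m :: 'n \<Rightarrow> nat. \<alpha> = (\<Sum>i\<in>UNIV. int (m i) *s E i)}"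


lemma ordered_basis_hom_eqI:
  assumes "ordered_basis B" "module_hom (*s) (*s) T" "module_hom (*s) (*s) T'"
    and "\<And>i. T (B i) = T' (B i)"
  shows "T = (T' :: int ^ 'n \<Rightarrow> int ^ 'n)"
proof -
  interpret T: module_hom "(*s)" "(*s)" "\<lambda>x. T x - T' x"
    using assms(2,3) by (auto simp: module_hom_iff algebra_simps int_vec.scale_right_diff_distrib)
  have "T x - T' x = 0" for x
    using T.eq_0_on_span[of "range B" x] assms(1,4) by (auto simp: ordered_basis_def)
  then show ?thesis by auto
qed

lemma ordered_basis_hom_exists:
  fixes B C :: "'n \<Rightarrow> int ^ 'n"
  assumes B: "ordered_basis B"
  obtains T where "module_hom (*s) (*s) T" "\<And>i. T (B i) = C i"
proof -
  define r where "r = int_vec.representation (range B)"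
  have ind: "int_vec.independent (range B)" and sp: "\<And>v. v \<in> int_vec.span (range B)" and "inj B"
    using B by (auto simp: ordered_basis_def)
  define T where "T v = (\<Sum>i\<in>UNIV. r v (B i) *s C i)" for v
  have "module_hom (*s) (*s) T"
    by (simp add: module_hom_iff int_vec.module_axioms T_def r_def
        int_vec.representation_add[OF ind sp sp] int_vec.representation_scale[OF ind sp]
        int_vec.scale_left_distrib sum.distrib int_vec.scale_sum_right)
  moreover have "T (B i) = C i" for i
  proof -
    have "r (B i) (B j) = (if j = i then 1 else 0)" for j
      using int_vec.representation_basis[OF ind, of "B i"] \<open>inj B\<close>
      by (auto simp: r_def inj_eq)
    then have "T (B i) = (\<Sum>j\<in>UNIV. if j = i then C j else 0)"
      unfolding T_def by (intro sum.cong) (auto simp: vec_eq_iff)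
    then show ?thesis by simp
  qed
  ultimately show ?thesis using that by blast
qed

lemma ordered_basis_aut_exists:
  assumes B: "ordered_basis B" and C: "ordered_basis C"
  obtains T where "lattice_aut T" "T \<circ> B = C"
proof -
  obtain T where T: "module_hom (*s) (*s) T" "\<And>i. T (B i) = C i"
    using ordered_basis_hom_exists[OF B] by blast
  obtain T' where T': "module_hom (*s) (*s) T'" "\<And>i. T' (C i) = B i"
    using ordered_basis_hom_exists[OF C] by blast
  have "T' \<circ> T = id" "T \<circ> T' = id"
    using ordered_basis_hom_eqI[OF B, of "T' \<circ> T" id] ordered_basis_hom_eqI[OF C, of "T \<circ> T'" id]
      T T' by (auto intro: module_hom_compose int_vec.module_hom_id)
  then have "lattice_aut T"
    using T(1) o_bij by (auto simp: lattice_aut_def)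
  then show ?thesis using that T(2) by (auto simp: fun_eq_iff)
qed

lemma ordered_basis_aut_image:
  assumes B: "ordered_basis B" and T: "lattice_aut T"
  shows "ordered_basis (T \<circ> B)"
proof -
  interpret T: module_hom "(*s)" "(*s)" T using T by (simp add: lattice_aut_def)
  have "inj T" "surj T" using T by (auto simp: lattice_aut_def bij_def)
  then have "int_vec.independent (T ` range B)" "int_vec.span (T ` range B) = UNIV" "inj (T \<circ> B)"
    using B T.independent_injective_image[of "range B"] T.span_image[of "range B"]
    by (auto simp: ordered_basis_def intro: inj_compose inj_on_subset)
  then show ?thesis by (simp add: ordered_basis_def image_comp)
qed

lemma reflection_props:
  assumes "ordered_basis E"
  shows "module_hom (*s) (*s) (reflection chi E i)"
    and "reflection chi E i (E i) = - E i"
    and "j \<noteq> i \<Longrightarrow> reflection chi E i (E j) = E j + int (refl_coeff chi E i j) *s E i"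
proof -
  define C where "C j = (if j = i then - E i else E j + int (refl_coeff chi E i j) *s E i)" for j
  let ?P = "\<lambda>T. module_hom (*s) (*s) T \<and> T (E i) = - E i \<and>
     (\<forall>j. j \<noteq> i \<longrightarrow> T (E j) = E j + int (refl_coeff chi E i j) *s E i)"
  have P: "?P T \<longleftrightarrow> module_hom (*s) (*s) T \<and> (\<forall>j. T (E j) = C j)" for T
    by (auto simp: C_def)
  have "\<exists>!T. ?P T"
    unfolding P using ordered_basis_hom_exists[OF assms, of C] ordered_basis_hom_eqI[OF assms]
    by metis
  from theI'[OF this] have "?P (reflection chi E i)"
    by (simp add: reflection_def)
  then show "module_hom (*s) (*s) (reflection chi E i)"
    and "reflection chi E i (E i) = - E i"
    and "j \<noteq> i \<Longrightarrow> reflection chi E i (E j) = E j + int (refl_coeff chi E i j) *s E i"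
    by blast+
qed

lemma reflection_reflection:
  assumes "ordered_basis E"
  shows "reflection chi E i (reflection chi E i v) = v"
proof -
  note s = reflection_props[OF assms, where chi = chi and i = i]
  interpret s: module_hom "(*s)" "(*s)" "reflection chi E i" by (fact s(1))
  have "reflection chi E i \<circ> reflection chi E i = id"
  proof (rule ordered_basis_hom_eqI[OF assms])
    show "module_hom (*s) (*s) (reflection chi E i \<circ> reflection chi E i)"
      by (rule module_hom_compose[OF s(1) s(1)])
    show "module_hom (*s) (*s) (id :: int ^ 'a \<Rightarrow> int ^ 'a)" by (rule int_vec.module_hom_id)
    show "(reflection chi E i \<circ> reflection chi E i) (E j) = id (E j)" for j
      by (cases "j = i") (simp_all add: s s.neg s.add s.scale)
  qed
  then show ?thesis by (simp add: fun_eq_iff)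
qed

lemma lattice_aut_reflection: "ordered_basis E \<Longrightarrow> lattice_aut (reflection chi E i)"
  by (auto simp: lattice_aut_def reflection_props(1) reflection_reflection intro: involuntory_imp_bij)

definition arrows_on :: "('n \<Rightarrow> int ^ 'n) set \<Rightarrow> 'n::finite arrow set" where
  "arrows_on R = {(T, B). lattice_aut T \<and> B \<in> R \<and> T \<circ> B \<in> R}"

lemma lattice_aut_id: "lattice_aut id"
  by (simp add: lattice_aut_def int_vec.module_hom_id)

lemma lattice_aut_comp: "lattice_aut T \<Longrightarrow> lattice_aut T' \<Longrightarrow> lattice_aut (T \<circ> T')"
  by (auto simp: lattice_aut_def intro: module_hom_compose bij_comp)

lemma lattice_aut_inv: "lattice_aut T \<Longrightarrow> lattice_aut (inv T)"
  using module_pair.bij_module_hom_imp_inv_module_hom[OF module_pair.intro,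
      OF int_vec.module_axioms int_vec.module_axioms]
  by (auto simp: lattice_aut_def bij_imp_bij_inv)

lemma lattice_aut_eqI:
  assumes "ordered_basis B" "lattice_aut T" "lattice_aut T'" "T \<circ> B = T' \<circ> B"
  shows "T = T'"
  using ordered_basis_hom_eqI[OF assms(1)] assms(2-) by (auto simp: lattice_aut_def fun_eq_iff)

lemma brandt_groupoid_connected:
  assumes "brandt_groupoid S f" "e \<in> S" "e' \<in> S" "f e e = Some e" "f e' e' = Some e'"
  obtains a where "a \<in> S" "f e a = Some a" "f a e' = Some a"
proof -
  have "\<forall>e\<in>S. \<forall>e'\<in>S. f e e = Some e \<and> f e' e' = Some e' \<longrightarrow>
      (\<exists>a\<in>S. f e a = Some a \<and> f a e' = Some a)"
    using assms(1) unfolding brandt_groupoid_def by (elim conjE)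
  with assms(2-) have "\<exists>a\<in>S. f e a = Some a \<and> f a e' = Some a" by simp
  then show ?thesis using that by blast
qed

lemma arrow_comp_eq_Some:
  "arrow_comp a b = Some c \<longleftrightarrow> fst b \<circ> snd b = snd a \<and> c = (fst a \<circ> fst b, snd b)"
  by (cases a; cases b) (auto simp: arrow_comp_def)

lemma brandt_groupoidI:
  assumes "S \<noteq> {}"
    and "\<And>a b c. a \<in> S \<Longrightarrow> b \<in> S \<Longrightarrow> f a b = Some c \<Longrightarrow> c \<in> S"
    and "\<And>a b b'. a \<in> S \<Longrightarrow> b \<in> S \<Longrightarrow> b' \<in> S \<Longrightarrow> f a b \<noteq> None \<Longrightarrow> f a b = f a b' \<Longrightarrow> b = b'"
    and "\<And>a a' b. a \<in> S \<Longrightarrow> a' \<in> S \<Longrightarrow> b \<in> S \<Longrightarrow> f a b \<noteq> None \<Longrightarrow> f a b = f a' b \<Longrightarrow> a = a'"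
    and "\<And>a b c x y. f a b = Some x \<Longrightarrow> f b c = Some y \<Longrightarrow> f x c \<noteq> None \<and> f x c = f a y"
    and "\<And>a b c x z. f a b = Some x \<Longrightarrow> f x c = Some z \<Longrightarrow> \<exists>y. f b c = Some y \<and> f a y = Some z"
    and "\<And>a b c y z. f b c = Some y \<Longrightarrow> f a y = Some z \<Longrightarrow> \<exists>x. f a b = Some x \<and> f x c = Some z"
    and "\<And>a. a \<in> S \<Longrightarrow> \<exists>!e. e \<in> S \<and> f e a = Some a"
    and "\<And>a. a \<in> S \<Longrightarrow> \<exists>!e. e \<in> S \<and> f a e = Some a"
    and "\<And>a e. a \<in> S \<Longrightarrow> e \<in> S \<Longrightarrow> f a e = Some a \<Longrightarrow> \<exists>!a'. a' \<in> S \<and> f a' a = Some e"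
    and "\<And>e e'. e \<in> S \<Longrightarrow> e' \<in> S \<Longrightarrow> f e e = Some e \<Longrightarrow> f e' e' = Some e' \<Longrightarrow>
      \<exists>a\<in>S. f e a = Some a \<and> f a e' = Some a"
  shows "brandt_groupoid S f"
  unfolding brandt_groupoid_def
  apply (intro conjI[OF assms(1)])
  apply (intro conjI)
           apply (intro ballI allI impI, rule assms(2); assumption)
          apply (intro ballI allI impI, elim conjE, rule assms(3); assumption)
         apply (intro ballI allI impI, elim conjE, rule assms(4); assumption)
        apply (intro ballI allI impI, elim conjE, rule assms(5); assumption)
       apply (intro ballI allI impI, elim conjE, rule assms(6); assumption)
      apply (intro ballI allI impI, elim conjE, rule assms(7); assumption)
     apply (intro ballI, rule assms(8); assumption)
    apply (intro ballI, rule assms(9); assumption)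
   apply (intro ballI impI, rule assms(10); assumption)
  apply (intro ballI impI, elim conjE, rule assms(11); assumption)
  done

lemma brandt_groupoid_arrows_on:
  assumes R: "\<And>B. B \<in> R \<Longrightarrow> ordered_basis B" and "R \<noteq> {}"
  shows "brandt_groupoid (arrows_on R) arrow_comp"
proof (rule brandt_groupoidI)
  show "arrows_on R \<noteq> {}"
    using \<open>R \<noteq> {}\<close> lattice_aut_id by (fastforce simp: arrows_on_def)
  show "\<exists>!e. e \<in> arrows_on R \<and> arrow_comp e a = Some a" if "a \<in> arrows_on R" for a
  proof -
    obtain T B where a: "a = (T, B)" "lattice_aut T" "B \<in> R" "T \<circ> B \<in> R"
      using \<open>a \<in> arrows_on R\<close> by (auto simp: arrows_on_def)
    have "e = (id, T \<circ> B)" if "arrow_comp e a = Some a" for e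
    proof -
      have "fst e \<circ> T = T" "snd e = T \<circ> B"
        using that a by (auto simp: arrow_comp_def split: prod.splits if_splits)
      moreover have "surj T" using a by (auto simp: lattice_aut_def bij_def)
      ultimately show ?thesis by (auto simp: prod_eq_iff fun_eq_iff surj_def) metis
    qed
    then show ?thesis
      using a lattice_aut_id by (intro ex1I[of _ "(id, T \<circ> B)"]) (auto simp: arrows_on_def arrow_comp_def)
  qed
  show "\<exists>!e. e \<in> arrows_on R \<and> arrow_comp a e = Some a" if "a \<in> arrows_on R" for a
  proof -
    obtain T B where a: "a = (T, B)" "lattice_aut T" "B \<in> R" "T \<circ> B \<in> R"
      using \<open>a \<in> arrows_on R\<close> by (auto simp: arrows_on_def)
    have "e = (id, B)" if "arrow_comp a e = Some a" for e
    proof -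
      have "T \<circ> fst e = T" "snd e = B"
        using that a by (auto simp: arrow_comp_def split: prod.splits if_splits)
      moreover have "inj T" using a by (auto simp: lattice_aut_def bij_def)
      ultimately show ?thesis by (auto simp: prod_eq_iff fun_eq_iff inj_eq)
    qed
    then show ?thesis
      using a lattice_aut_id by (intro ex1I[of _ "(id, B)"]) (auto simp: arrows_on_def arrow_comp_def)
  qed
  show "\<exists>!a'. a' \<in> arrows_on R \<and> arrow_comp a' a = Some e"
    if "a \<in> arrows_on R" "e \<in> arrows_on R" "arrow_comp a e = Some a" for a e
  proof -
    obtain T B where a: "a = (T, B)" "lattice_aut T" "B \<in> R" "T \<circ> B \<in> R"
      using \<open>a \<in> arrows_on R\<close> by (auto simp: arrows_on_def)
    have T: "inv T \<circ> T = id" "T \<circ> inv T = id"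
      using a(2) by (auto simp: lattice_aut_def bij_def surj_iff)
    have e: "e = (id, B)"
    proof -
      have "T \<circ> fst e = T" "snd e = B"
        using that a by (auto simp: arrow_comp_def split: prod.splits if_splits)
      moreover have "inj T" using a by (auto simp: lattice_aut_def bij_def)
      ultimately show ?thesis by (auto simp: prod_eq_iff fun_eq_iff inj_eq)
    qed
    have "a' = (inv T, T \<circ> B)" if "arrow_comp a' a = Some e" for a'
    proof -
      have "fst a' \<circ> T = id" "snd a' = T \<circ> B"
        using that a e by (auto simp: arrow_comp_def split: prod.splits if_splits)
      moreover have "fst a' = (fst a' \<circ> T) \<circ> inv T" using T by (simp add: comp_assoc)
      ultimately show ?thesis by (simp add: prod_eq_iff)
    qed
    moreover have "inv T \<circ> (T \<circ> B) = B" using T by (simp add: comp_assoc[symmetric])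
    ultimately show ?thesis
      using a T e lattice_aut_inv[OF a(2)]
      by (intro ex1I[of _ "(inv T, T \<circ> B)"]) (auto simp: arrows_on_def arrow_comp_def)
  qed
  show "\<exists>a\<in>arrows_on R. arrow_comp e a = Some a \<and> arrow_comp a e' = Some a"
    if ee': "e \<in> arrows_on R" "e' \<in> arrows_on R"
      "arrow_comp e e = Some e" "arrow_comp e' e' = Some e'" for e e'
  proof -
    have unit: "\<exists>B. B \<in> R \<and> e = (id, B)"
      if e: "e \<in> arrows_on R" "arrow_comp e e = Some e" for e
    proof -
      obtain T B where *: "e = (T, B)" "lattice_aut T" "B \<in> R" "T \<circ> B = B"
        using e by (auto simp: arrows_on_def arrow_comp_def split: if_splits)
      then have "T = id"
        using lattice_aut_eqI[OF R, of B T id] lattice_aut_id by auto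
      with * show ?thesis by blast
    qed
    obtain B B' where B: "B \<in> R" "e = (id, B)" "B' \<in> R" "e' = (id, B')"
      using unit ee' by metis
    obtain T where "lattice_aut T" "T \<circ> B' = B"
      using ordered_basis_aut_exists R B by blast
    with B show ?thesis
      by (intro bexI[of _ "(T, B')"]) (auto simp: arrows_on_def arrow_comp_def)
  qed
  show "b = b'" if "a \<in> arrows_on R" "b \<in> arrows_on R" "b' \<in> arrows_on R"
    "arrow_comp a b \<noteq> None" "arrow_comp a b = arrow_comp a b'" for a b b'
  proof -
    have "snd b = snd b'" "fst b \<circ> snd b = fst b' \<circ> snd b"
      using that by (auto simp: arrow_comp_def split: prod.splits if_splits)
    moreover from this have "fst b = fst b'"
      using that R by (intro lattice_aut_eqI[of "snd b"]) (auto simp: arrows_on_def)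
    ultimately show ?thesis by (simp add: prod_eq_iff)
  qed
  show "a = a'" if "a \<in> arrows_on R" "a' \<in> arrows_on R" "b \<in> arrows_on R"
    "arrow_comp a b \<noteq> None" "arrow_comp a b = arrow_comp a' b" for a a' b
    using that R
    by (auto simp: arrows_on_def arrow_comp_def comp_assoc[symmetric] split: if_splits
        intro!: lattice_aut_eqI)
  show "c \<in> arrows_on R" if "a \<in> arrows_on R" "b \<in> arrows_on R"
    "arrow_comp a b = Some c" for a b c
  proof -
    have c: "fst b \<circ> snd b = snd a" "c = (fst a \<circ> fst b, snd b)"
      using that by (simp_all add: arrow_comp_eq_Some)
    then have "(fst a \<circ> fst b) \<circ> snd b = fst a \<circ> snd a" by (simp only: comp_assoc)
    with that c show ?thesis by (simp add: arrows_on_def case_prod_beta lattice_aut_comp)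
  qed
  show "arrow_comp x c \<noteq> None \<and> arrow_comp x c = arrow_comp a y"
    if "arrow_comp a b = Some x" "arrow_comp b c = Some y" for a b c x and y :: "'a arrow"
  proof -
    have "arrow_comp x c = Some (fst a \<circ> fst b \<circ> fst c, snd c)"
      "arrow_comp a y = Some (fst a \<circ> fst b \<circ> fst c, snd c)"
      using that by (simp_all add: arrow_comp_eq_Some comp_assoc)
    then show ?thesis by simp
  qed
  show "\<exists>y. arrow_comp b c = Some y \<and> arrow_comp a y = Some z"
    if "arrow_comp a b = Some x" "arrow_comp x c = Some z" for a b c x and z :: "'a arrow"
    using that by (simp add: arrow_comp_eq_Some comp_assoc)
  show "\<exists>x. arrow_comp a b = Some x \<and> arrow_comp x c = Some z"
    if "arrow_comp b c = Some y" "arrow_comp a y = Some z" for a b c y and z :: "'a arrow"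
    using that by (simp add: arrow_comp_eq_Some comp_assoc)
qed

lemma ordered_basis_axis: "ordered_basis (\<lambda>i. axis i 1 :: int ^ 'n)"
proof -
  have sum: "(\<Sum>i\<in>UNIV. c i *s axis i 1) = (\<chi> i. c i)" for c :: "'n \<Rightarrow> int"
    by (simp add: vec_eq_iff axis_def if_distrib cong: if_cong)
  have inj: "inj (\<lambda>i. axis i 1 :: int ^ 'n)"
    by (auto simp: inj_def axis_eq_axis)
  have "int_vec.independent (range (\<lambda>i. axis i 1 :: int ^ 'n))"
    using sum by (auto simp: int_vec.dependent_finite sum.reindex[OF inj] vec_eq_iff)
  moreover have "v \<in> int_vec.span (range (\<lambda>i. axis i 1))" for v :: "int ^ 'n"
  proof -
    have "(\<Sum>i\<in>UNIV. v $ i *s axis i 1) \<in> int_vec.span (range (\<lambda>i. axis i 1))"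
      by (intro int_vec.span_sum int_vec.span_scale int_vec.span_base) auto
    then show ?thesis using sum[of "($) v"] by simp
  qed
  ultimately show ?thesis using inj by (auto simp: ordered_basis_def)
qed

lemma brandt_groupoid_full: "brandt_groupoid full_groupoid (arrow_comp :: 'n::finite arrow \<Rightarrow> _)"
proof -
  have "full_groupoid = arrows_on {B :: 'n \<Rightarrow> int ^ 'n. ordered_basis B}"
    by (auto simp: full_groupoid_def arrows_on_def ordered_basis_aut_image)
  then show ?thesis
    using brandt_groupoid_arrows_on[of "{B :: 'n \<Rightarrow> int ^ 'n. ordered_basis B}"] ordered_basis_axis
    by auto
qed

inductive_set weyl_bases ::
  "(int ^ 'n \<Rightarrow> int ^ 'n \<Rightarrow> 'k::field) \<Rightarrow> ('n \<Rightarrow> int ^ 'n) \<Rightarrow> ('n \<Rightarrow> int ^ 'n) set"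
  for chi E where
  base: "E \<in> weyl_bases chi E"
| step: "B \<in> weyl_bases chi E \<Longrightarrow> reflection_defined chi B i \<Longrightarrow>
    reflection chi B i \<circ> B \<in> weyl_bases chi E"

lemma weyl_bases_ordered_basis:
  assumes "ordered_basis E" "B \<in> weyl_bases chi E"
  shows "ordered_basis B"
  using assms(2,1)
  by induction (auto intro: ordered_basis_aut_image lattice_aut_reflection)

lemma weyl_closed_arrows_on:
  assumes E: "ordered_basis E"
  shows "weyl_closed chi E (arrows_on (weyl_bases chi E))"
proof -
  have "brandt_groupoid (arrows_on (weyl_bases chi E)) arrow_comp"
    using weyl_bases_ordered_basis[OF E] weyl_bases.base[of E chi]
    by (intro brandt_groupoid_arrows_on) auto
  moreover have "arrows_on (weyl_bases chi E) \<subseteq> full_groupoid"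
    using weyl_bases_ordered_basis[OF E] by (auto simp: arrows_on_def full_groupoid_def)
  moreover have id: "(id, B) \<in> arrows_on (weyl_bases chi E) \<longleftrightarrow> B \<in> weyl_bases chi E" for B
    by (simp add: arrows_on_def lattice_aut_id)
  moreover have "(reflection chi B i, B) \<in> arrows_on (weyl_bases chi E)"
    if "B \<in> weyl_bases chi E" "reflection_defined chi B i" for B i
    using that weyl_bases.step[OF that] weyl_bases_ordered_basis[OF E that(1)]
    by (simp add: arrows_on_def lattice_aut_reflection)
  ultimately show ?thesis
    unfolding weyl_closed_def brandt_subgroupoid_def id
    using weyl_bases.base weyl_bases.step by blast
qed

lemma arrows_on_subset_weyl_closed:
  fixes E :: "'n \<Rightarrow> int ^ 'n"
  assumes E: "ordered_basis E" and U: "weyl_closed chi E U"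
  shows "arrows_on (weyl_bases chi E) \<subseteq> U"
proof (rule subrelI)
  fix T and B :: "'n \<Rightarrow> int ^ 'n"
  assume "(T, B) \<in> arrows_on (weyl_bases chi E)"
  then have TB: "lattice_aut T" "B \<in> weyl_bases chi E" "T \<circ> B \<in> weyl_bases chi E"
    by (auto simp: arrows_on_def)
  have U': "(id, E) \<in> U" "brandt_groupoid U arrow_comp" "U \<subseteq> full_groupoid"
    "\<And>B i. (id, B) \<in> U \<Longrightarrow> reflection_defined chi B i \<Longrightarrow> (id, reflection chi B i \<circ> B) \<in> U"
    using U unfolding weyl_closed_def brandt_subgroupoid_def by iprover+
  have id: "(id, B) \<in> U" if "B \<in> weyl_bases chi E" for B
    using that by induction (rule U'(1), rule U'(4))
  have "arrow_comp (id, B) (id, B) = Some (id, B)" for B :: "'n \<Rightarrow> int ^ 'n"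
    by (simp add: arrow_comp_eq_Some)
  then obtain a where a: "a \<in> U" "arrow_comp (id, T \<circ> B) a = Some a" "arrow_comp a (id, B) = Some a"
    using brandt_groupoid_connected[OF U'(2) id[OF TB(3)] id[OF TB(2)]] by blast
  have snd: "snd a = B" and fst: "fst a \<circ> B = T \<circ> B"
    using conjunct1[OF a(2)[unfolded arrow_comp_eq_Some]]
      conjunct1[OF a(3)[unfolded arrow_comp_eq_Some]] by simp_all
  have "lattice_aut (fst a)"
    using subsetD[OF U'(3) a(1)] by (auto simp: full_groupoid_def)
  then have "fst a = T"
    by (rule lattice_aut_eqI[OF weyl_bases_ordered_basis[OF E TB(2)] _ TB(1) fst])
  then have "a = (T, B)" using snd by (simp add: prod_eq_iff)
  then show "(T, B) \<in> U" using a(1) by simp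
qed

lemma weyl_groupoid_eq:
  assumes "ordered_basis E"
  shows "weyl_groupoid chi E = arrows_on (weyl_bases chi E)"
  unfolding weyl_groupoid_def
proof (rule antisym)
  show "\<Inter> {U. weyl_closed chi E U} \<subseteq> arrows_on (weyl_bases chi E)"
    by (rule Inter_lower) (simp add: weyl_closed_arrows_on assms)
  show "arrows_on (weyl_bases chi E) \<subseteq> \<Inter> {U. weyl_closed chi E U}"
    by (rule Inter_greatest) (simp add: arrows_on_subset_weyl_closed assms)
qed

lemma weyl_groupoid_least:
  assumes "ordered_basis E"
  shows "weyl_closed chi E (weyl_groupoid chi E)"
    and "weyl_closed chi E U \<Longrightarrow> weyl_groupoid chi E \<subseteq> U"
  by (simp_all add: weyl_groupoid_eq weyl_closed_arrows_on arrows_on_subset_weyl_closed assms)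

end

theory Submission
  imports Defs "HOL-Algebra.Algebraic_Closure_Type" "HOL-Library.Function_Algebras"
begin

text \<open>
  Let the Drinfeld double with generators \<open>e\<^sub>i, f\<^sub>i\<close> attached to \<open>\<chi>\<close> and the basis \<open>E\<close> act on a simple
  graded module with a highest weight vector \<open>v\<close> of weight \<open>0\<close>, so that all weights lie in the
  negative cone of \<open>E\<close>. If \<open>\<chi>(e\<^sub>i, e\<^sub>i) \<noteq> 1\<close> is a root of unity, Lusztig's formulas turn the
  operators into generators for the reflected basis: the Serre relations they need hold because
  the Serre elements commute with all \<open>f\<^sub>k\<close> (respectively \<open>e\<^sub>k\<close>) and hence vanish on a simple highest
  weight module, and the last nonzero \<open>f\<^sub>i\<^sup>M v\<close> is a highest weight vector for the new basis. So
  each basis \<open>B\<close> of the Weyl groupoid acts on the same module, and for \<open>\<beta> \<in> B\<close> the commutator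
  \<open>e\<^sub>\<beta> f\<^sub>\<beta> v - f\<^sub>\<beta> e\<^sub>\<beta> v\<close> is a multiple of \<open>v\<close>, nonzero for a suitable choice of the module. Hence
  \<open>f\<^sub>\<beta> v\<close> or \<open>e\<^sub>\<beta> v\<close> is nonzero, and its weight \<open>-\<beta>\<close> or \<open>\<beta>\<close> lies in the negative cone of \<open>E\<close>.

  The reduction to roots of unity uses that only finitely many scalars enter the definition of
  the finitely many bases, and that finitely many nontrivial elements of a finitely generated
  subgroup of a field of characteristic zero can be kept nontrivial by a homomorphism to roots
  of unity. If \<open>\<chi>(e\<^sub>i, e\<^sub>i) = 1\<close>, then \<open>s\<^sub>i\<close> only changes the sign of \<open>e\<^sub>i\<close>.
\<close>

section \<open>Separating finitely many scalars by torsion characters\<close>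

definition mult_subgroup :: "'a::field set \<Rightarrow> bool" where
  "mult_subgroup G \<longleftrightarrow> 1 \<in> G \<and> 0 \<notin> G \<and> (\<forall>x\<in>G. \<forall>y\<in>G. x * y \<in> G) \<and> (\<forall>x\<in>G. inverse x \<in> G)"

definition root_of_unity :: "'a::field \<Rightarrow> bool" where
  "root_of_unity x \<longleftrightarrow> (\<exists>n>0. x ^ n = 1)"

definition torsion_char :: "'a::field set \<Rightarrow> ('a \<Rightarrow> 'b::field) \<Rightarrow> bool" where
  "torsion_char G \<phi> \<longleftrightarrow>
     (\<forall>x\<in>G. \<forall>y\<in>G. \<phi> (x * y) = \<phi> x * \<phi> y) \<and> (\<forall>x\<in>G. root_of_unity (\<phi> x))"

lemma mult_subgroupD:
  assumes "mult_subgroup G"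
  shows "1 \<in> G" "x \<in> G \<Longrightarrow> x \<noteq> 0" "x \<in> G \<Longrightarrow> y \<in> G \<Longrightarrow> x * y \<in> G"
    "x \<in> G \<Longrightarrow> inverse x \<in> G"
  using assms by (auto simp: mult_subgroup_def)

lemma mult_subgroup_power: "mult_subgroup G \<Longrightarrow> x \<in> G \<Longrightarrow> x ^ n \<in> G"
  by (induction n) (auto simp: mult_subgroupD)

lemma mult_subgroup_powi: "mult_subgroup G \<Longrightarrow> x \<in> G \<Longrightarrow> x powi n \<in> G"
  by (auto simp: power_int_def mult_subgroupD mult_subgroup_power)

lemma root_of_unity_nonzero: "root_of_unity x \<Longrightarrow> x \<noteq> 0"
  by (auto simp: root_of_unity_def power_0_left)

lemma root_of_unity_mult: "root_of_unity x \<Longrightarrow> root_of_unity y \<Longrightarrow> root_of_unity (x * y)"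
proof -
  assume "root_of_unity x" "root_of_unity y"
  then obtain m n where "m > 0" "x ^ m = 1" "n > 0" "y ^ n = 1"
    by (auto simp: root_of_unity_def)
  then have "(x * y) ^ (m * n) = (x ^ m) ^ n * (y ^ n) ^ m"
    by (metis power_mult_distrib power_mult mult.commute)
  with \<open>m > 0\<close> \<open>n > 0\<close> \<open>x ^ m = 1\<close> \<open>y ^ n = 1\<close> show ?thesis
    unfolding root_of_unity_def by (intro exI[of _ "m * n"]) simp
qed

lemma root_of_unity_inverse: "root_of_unity x \<Longrightarrow> root_of_unity (inverse x)"
  by (auto simp: root_of_unity_def power_inverse)

lemma root_of_unity_power_iff: "m > 0 \<Longrightarrow> root_of_unity (x ^ m) \<longleftrightarrow> root_of_unity x"
  unfolding root_of_unity_def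
  by (metis nat_0_less_mult_iff power_mult power_one mult.commute)

lemma root_of_unity_powi: "root_of_unity x \<Longrightarrow> root_of_unity (x powi n)"
proof -
  assume x: "root_of_unity x"
  then have "root_of_unity (x ^ m)" for m
    using root_of_unity_power_iff[of m x] by (cases "m = 0") (auto simp: root_of_unity_def intro: exI[of _ 1])
  then show ?thesis by (auto simp: power_int_def root_of_unity_inverse power_inverse)
qed

lemma mult_subgroup_roots_of_unity: "mult_subgroup {x. root_of_unity x}"
  using root_of_unity_nonzero
  by (auto simp: mult_subgroup_def root_of_unity_mult root_of_unity_inverse)
    (auto simp: root_of_unity_def)

lemma torsion_char_one: "torsion_char G \<phi> \<Longrightarrow> mult_subgroup G \<Longrightarrow> \<phi> 1 = 1"
proof -
  assume "torsion_char G \<phi>" "mult_subgroup G"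
  then have "\<phi> (1 * 1) = \<phi> 1 * \<phi> 1" "\<phi> 1 \<noteq> 0"
    using mult_subgroupD(1)[of G] root_of_unity_nonzero unfolding torsion_char_def by blast+
  then show ?thesis by simp
qed

lemma torsion_char_power:
  "torsion_char G \<phi> \<Longrightarrow> mult_subgroup G \<Longrightarrow> x \<in> G \<Longrightarrow> \<phi> (x ^ n) = \<phi> x ^ n"
proof (induction n)
  case 0
  then show ?case by (simp add: torsion_char_one)
next
  case (Suc n)
  then show ?case
    by (simp add: torsion_char_def mult_subgroup_power)
qed

lemma torsion_char_inverse:
  assumes "torsion_char G \<phi>" "mult_subgroup G" "x \<in> G"
  shows "\<phi> (inverse x) = inverse (\<phi> x)"
proof -
  have "\<phi> (inverse x * x) = \<phi> (inverse x) * \<phi> x"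
    using assms mult_subgroupD(4) unfolding torsion_char_def by blast
  then have "\<phi> (inverse x) * \<phi> x = 1"
    using assms mult_subgroupD(2)[OF assms(2,3)] by (simp add: torsion_char_one)
  then show ?thesis by (metis inverse_unique mult.commute)
qed

lemma torsion_char_powi:
  "torsion_char G \<phi> \<Longrightarrow> mult_subgroup G \<Longrightarrow> x \<in> G \<Longrightarrow> \<phi> (x powi n) = \<phi> x powi n"
  by (auto simp: power_int_def torsion_char_power torsion_char_inverse mult_subgroupD)

section \<open>Extending torsion characters by one generator\<close>

definition adjoin :: "'a::field set \<Rightarrow> 'a \<Rightarrow> 'a set" where
  "adjoin G g = {x * g powi e | x e. x \<in> G}"

lemma adjoinI: "x \<in> G \<Longrightarrow> x * g powi e \<in> adjoin G g"
  by (auto simp: adjoin_def)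

lemma adjoin_superset: "G \<subseteq> adjoin G g"
  using adjoinI[of _ G g 0] by auto

lemma mult_subgroup_adjoin:
  assumes "mult_subgroup G" "g \<noteq> 0"
  shows "mult_subgroup (adjoin G g)" "g \<in> adjoin G g"
proof -
  note G = mult_subgroupD[OF assms(1)]
  have "x * g powi e * (y * g powi f) \<in> adjoin G g" if "x \<in> G" "y \<in> G" for x y e f
    using adjoinI[of "x * y" G g "e + f"] that assms(2) G
    by (simp add: power_int_add mult_ac)
  moreover have "inverse (x * g powi e) \<in> adjoin G g" if "x \<in> G" for x e
    using adjoinI[of "inverse x" G g "- e"] that G
    by (simp add: power_int_minus)
  moreover have "1 \<in> adjoin G g" using adjoin_superset G(1) by blast
  moreover have "0 \<notin> adjoin G g" using assms by (auto simp: adjoin_def mult_subgroup_def)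
  ultimately show "mult_subgroup (adjoin G g)"
    unfolding mult_subgroup_def by (auto simp: adjoin_def)
  show "g \<in> adjoin G g" using adjoinI[of 1 G g 1] G by simp
qed

text \<open>Two representations \<open>x * g powi e\<close> of one element differ by a power of
  \<open>g\<close> lying in \<open>G\<close>, and \<open>compat\<close> says that
  \<open>\<phi>\<close> and \<open>\<zeta>\<close> agree on such powers; so the prescribed value
  does not depend on the representation.\<close>

lemma torsion_char_adjoin:
  fixes \<phi> :: "'a::field \<Rightarrow> 'b::field"
  assumes G: "mult_subgroup G" and \<phi>: "torsion_char G \<phi>" and g: "g \<noteq> 0" and \<zeta>: "root_of_unity \<zeta>"
    and compat: "\<And>e. g powi e \<in> G \<Longrightarrow> \<phi> (g powi e) = \<zeta> powi e"
  obtains \<psi> where "torsion_char (adjoin G g) \<psi>"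
    "\<And>x e. x \<in> G \<Longrightarrow> \<psi> (x * g powi e) = \<phi> x * \<zeta> powi e"
proof -
  note GD = mult_subgroupD[OF G]
  have mult: "\<phi> (x * y) = \<phi> x * \<phi> y" if "x \<in> G" "y \<in> G" for x y
    using \<phi> that by (simp add: torsion_char_def)
  have \<zeta>0: "\<zeta> \<noteq> 0" using \<zeta> root_of_unity_nonzero by blast
  have unique: "\<phi> x * \<zeta> powi e = \<phi> y * \<zeta> powi f"
    if "x \<in> G" "y \<in> G" "x * g powi e = y * g powi f" for x y e f
  proof -
    have gef: "g powi (e - f) = y * inverse x"
      using that(3) g GD(2)[OF that(1)] by (simp add: power_int_diff field_simps)
    then have "g powi (e - f) \<in> G" using GD that by simp
    then have "\<zeta> powi (e - f) = \<phi> (y * inverse x)" using compat[of "e - f"] gef by metis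
    also have "\<dots> = \<phi> y * inverse (\<phi> x)"
      using mult GD that torsion_char_inverse[OF \<phi> G] by simp
    finally have "\<zeta> powi (e - f) = \<phi> y * inverse (\<phi> x)" .
    moreover have "\<phi> x \<noteq> 0"
      using \<phi> that root_of_unity_nonzero unfolding torsion_char_def by blast
    ultimately show ?thesis
      using \<zeta>0 by (simp add: power_int_diff field_simps)
  qed
  define \<psi> where "\<psi> z = (THE w. \<exists>x\<in>G. \<exists>e. z = x * g powi e \<and> w = \<phi> x * \<zeta> powi e)" for z
  have \<psi>: "\<psi> (x * g powi e) = \<phi> x * \<zeta> powi e" if "x \<in> G" for x e
    unfolding \<psi>_def using that by (intro the_equality) (auto intro: unique)
  have "\<psi> ((x * g powi e) * (y * g powi f)) = \<psi> (x * g powi e) * \<psi> (y * g powi f)"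
    if "x \<in> G" "y \<in> G" for x y e f
  proof -
    have "(x * g powi e) * (y * g powi f) = (x * y) * g powi (e + f)"
      using g by (simp add: power_int_add mult_ac)
    then have "\<psi> ((x * g powi e) * (y * g powi f)) = \<phi> (x * y) * \<zeta> powi (e + f)"
      using \<psi> GD(3)[OF that] by metis
    then show ?thesis using \<psi>[OF that(1)] \<psi>[OF that(2)] mult[OF that] \<zeta>0
      by (simp add: power_int_add mult_ac)
  qed
  moreover have "root_of_unity (\<psi> (x * g powi e))" if "x \<in> G" for x e
    using \<psi>[OF that] \<phi> that \<zeta>
    by (simp add: torsion_char_def root_of_unity_mult root_of_unity_powi)
  ultimately have "torsion_char (adjoin G g) \<psi>"
    by (auto simp: torsion_char_def adjoin_def)
  then show ?thesis using that \<psi> by blast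
qed

text \<open>
  Fixing the characters on all roots of unity is what drives the induction on generators: an
  element of infinite order remains nontrivial after raising it to a power, and the power can be
  chosen to lie in the smaller group.
\<close>

definition separated_by_torsion_chars :: "'a::field set \<Rightarrow> bool" where
  "separated_by_torsion_chars G \<longleftrightarrow>
     (\<forall>A. finite A \<longrightarrow> A \<subseteq> G \<longrightarrow> 1 \<notin> A \<longrightarrow> (\<exists>\<phi> :: 'a \<Rightarrow> 'a alg_closure.
        torsion_char G \<phi> \<and> 1 \<notin> \<phi> ` A \<and> (\<forall>x. root_of_unity x \<longrightarrow> \<phi> x = to_ac x)))"

text \<open>Either no power of \<open>g\<close> with nonzero exponent lies in \<open>G\<close>, and
  \<open>g\<close> may go to any root of unity; or there is a least \<open>m > 0\<close> with
  \<open>g ^ m\<close> in \<open>G\<close>, and \<open>g\<close> must go to an \<open>m\<close>-th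
  root of \<open>\<phi> (g ^ m)\<close>.\<close>

lemma separated_by_torsion_chars_adjoin:
  fixes G :: "'a::field_char_0 set"
  assumes G: "mult_subgroup G" and T: "{x. root_of_unity x} \<subseteq> G"
    and sep: "separated_by_torsion_chars G" and g: "g \<noteq> 0"
  shows "separated_by_torsion_chars (adjoin G g)"
  unfolding separated_by_torsion_chars_def
proof (intro allI impI)
  fix A assume A: "finite A" "A \<subseteq> adjoin G g" "1 \<notin> A"
  note GD = mult_subgroupD[OF G]
  show "\<exists>\<psi> :: 'a \<Rightarrow> 'a alg_closure. torsion_char (adjoin G g) \<psi> \<and> 1 \<notin> \<psi> ` A \<and>
    (\<forall>x. root_of_unity x \<longrightarrow> \<psi> x = to_ac x)"
  proof (cases "\<forall>e. e \<noteq> 0 \<longrightarrow> g powi e \<notin> G")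
    case free: True
    from sep A obtain \<phi> :: "'a \<Rightarrow> 'a alg_closure" where
      \<phi>: "torsion_char G \<phi>" "1 \<notin> \<phi> ` (A \<inter> G)" "\<And>x. root_of_unity x \<Longrightarrow> \<phi> x = to_ac x"
      unfolding separated_by_torsion_chars_def
      by (metis IntD1 Int_lower2 finite_Int)
    have "\<exists>y e. y \<in> G \<and> x = y * g powi e" if "x \<in> A" for x
      using that A(2) unfolding adjoin_def by blast
    then obtain y e where ye: "\<And>x. x \<in> A \<Longrightarrow> y x \<in> G \<and> x = y x * g powi e x" by metis
    have "\<exists>d>0. \<phi> (y x) ^ d = 1" if "x \<in> A" for x
      using ye[OF that] \<phi>(1) by (auto simp: torsion_char_def root_of_unity_def)
    then obtain d where d: "\<And>x. x \<in> A \<Longrightarrow> d x > 0 \<and> \<phi> (y x) ^ d x = 1" by metis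
    \<comment> \<open>If \<open>\<psi> x = 1\<close> for some \<open>x\<close> in
      \<open>A - G\<close>, the power \<open>d x\<close> removes \<open>\<phi> (y x)\<close> and
      leaves \<open>\<zeta> ^ (d x * nat \<bar>e x\<bar>) = 1\<close>. That exponent divides
      \<open>n\<close>, so \<open>\<zeta> ^ n = - 1\<close> excludes all these cases at
      once.\<close>
    define n where "n = (\<Prod>x\<in>A - G. d x * nat \<bar>e x\<bar>)"
    have e: "e x \<noteq> 0" if "x \<in> A - G" for x
      using ye[of x] that by auto
    then have "n > 0" unfolding n_def using d by (intro prod_pos) auto
    then obtain \<zeta> :: "'a alg_closure" where \<zeta>: "\<zeta> ^ n = - 1"
      using nth_root_exists by blast
    then have "\<zeta> ^ (n * 2) = 1" by (simp add: power_mult)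
    then have \<zeta>1: "root_of_unity \<zeta>"
      using \<open>n > 0\<close> unfolding root_of_unity_def by (intro exI[of _ "n * 2"]) simp
    have compat: "\<phi> (g powi e) = \<zeta> powi e" if "g powi e \<in> G" for e
    proof -
      have "e = 0" using that free by blast
      then show ?thesis by (simp add: torsion_char_one[OF \<phi>(1) G])
    qed
    obtain \<psi> where \<psi>: "torsion_char (adjoin G g) \<psi>"
      "\<And>x e. x \<in> G \<Longrightarrow> \<psi> (x * g powi e) = \<phi> x * \<zeta> powi e"
      using torsion_char_adjoin[OF G \<phi>(1) g \<zeta>1 compat] by blast
    have \<psi>G: "\<psi> x = \<phi> x" if "x \<in> G" for x using \<psi>(2)[OF that, of 0] by simp
    have "\<psi> x \<noteq> 1" if "x \<in> A" for x
    proof (cases "x \<in> G")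
      case True
      then show ?thesis using \<psi>G \<phi>(2) that by (metis IntI image_eqI)
    next
      case False
      show ?thesis
      proof
        assume "\<psi> x = 1"
        then have "\<phi> (y x) * \<zeta> powi e x = 1"
          using \<psi>(2)[of "y x" "e x"] ye[OF that] by simp
        then have "(\<phi> (y x) * \<zeta> powi e x) ^ d x = 1" by simp
        then have "(\<zeta> powi e x) ^ d x = 1" using d[OF that] by (simp add: power_mult_distrib)
        then have "\<zeta> ^ (d x * nat \<bar>e x\<bar>) = 1"
          by (cases "e x \<ge> 0") (simp_all add: power_int_def power_mult mult.commute
              field_simps flip: power_mult)
        moreover have "d x * nat \<bar>e x\<bar> dvd n"
          unfolding n_def using A(1) that False by (intro dvd_prodI) auto
        ultimately have "\<zeta> ^ n = 1" by (auto elim!: dvdE simp: power_mult)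
        then show False using \<zeta> by simp
      qed
    qed
    then show ?thesis using \<psi>(1) \<psi>G \<phi>(3) T by (intro exI[of _ \<psi>]) auto
  next
    case False
    have "\<exists>m>0. g ^ m \<in> G"
    proof -
      obtain e where e: "e \<noteq> 0" "g powi e \<in> G" using False by blast
      then have "g powi \<bar>e\<bar> \<in> G"
        using GD(4)[OF e(2)] by (cases "e \<ge> 0") (auto simp flip: power_int_minus)
      then have "g ^ nat \<bar>e\<bar> \<in> G" by (simp add: power_int_def)
      then show ?thesis using e(1) by (intro exI[of _ "nat \<bar>e\<bar>"]) auto
    qed
    then obtain m where m: "m > 0" "g ^ m \<in> G" and min: "\<And>l. 0 < l \<Longrightarrow> l < m \<Longrightarrow> g ^ l \<notin> G"
      using exists_least_iff[of "\<lambda>m. m > 0 \<and> g ^ m \<in> G"] by blast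
    have dvd: "int m dvd e" if "g powi e \<in> G" for e
    proof -
      define r where "r = nat (e mod int m)"
      obtain c where e: "e = int m * c + int r"
        using m(1) mult_div_mod_eq[of "int m" e] by (metis r_def nat_mod_distrib of_nat_0_less_iff pos_mod_sign nat_0_le)
      have "g ^ r = g powi e * inverse ((g ^ m) powi c)"
        using g by (simp add: e power_int_add power_int_mult)
      also have "\<dots> \<in> G" using that m GD mult_subgroup_powi[OF G] by simp
      finally have "g ^ r \<in> G" .
      moreover have "r < m" using m(1) by (simp add: r_def nat_less_iff)
      ultimately have "r = 0" using min by auto
      then show ?thesis using e by (metis dvd_triv_left of_nat_0 add_0_right)
    qed
    \<comment> \<open>The \<open>m\<close>-th powers of the elements of infinite order lie in
      \<open>G\<close> and are still nontrivial. The power of a root of unity could be 1, but the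
      root itself already lies in \<open>G\<close>.\<close>
    define A' where "A' = (\<lambda>x. x ^ m) ` {x \<in> A. \<not> root_of_unity x} \<union> {x \<in> A. root_of_unity x}"
    have pow: "x ^ m \<in> G" if "x \<in> A" for x
    proof -
      obtain y e where "y \<in> G" "x = y * g powi e" using \<open>x \<in> A\<close> A(2) unfolding adjoin_def by blast
      then have "x ^ m = y ^ m * (g ^ m) powi e"
        by (simp add: power_mult_distrib power_int_power power_int_power' mult.commute)
      then show ?thesis using \<open>y \<in> G\<close> m GD mult_subgroup_powi[OF G] mult_subgroup_power[OF G] by simp
    qed
    have "x ^ m \<noteq> 1" if "\<not> root_of_unity x" for x :: 'a
      using that m(1) unfolding root_of_unity_def by blast
    then have "finite A'" "A' \<subseteq> G" "1 \<notin> A'"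
      using A pow T by (auto simp: A'_def)
    then obtain \<phi> :: "'a \<Rightarrow> 'a alg_closure" where
      \<phi>: "torsion_char G \<phi>" "1 \<notin> \<phi> ` A'" "\<And>x. root_of_unity x \<Longrightarrow> \<phi> x = to_ac x"
      using sep unfolding separated_by_torsion_chars_def by metis
    obtain \<zeta> where \<zeta>: "\<zeta> ^ m = \<phi> (g ^ m)" using nth_root_exists[OF m(1)] by blast
    have "root_of_unity \<zeta>"
      using \<zeta> \<phi>(1) m root_of_unity_power_iff[OF m(1), of \<zeta>] by (simp add: torsion_char_def)
    moreover have "\<phi> (g powi e) = \<zeta> powi e" if "g powi e \<in> G" for e
    proof -
      obtain c where c: "e = int m * c" using dvd[OF \<open>g powi e \<in> G\<close>] by auto
      have "\<phi> (g powi e) = \<phi> ((g ^ m) powi c)" by (simp add: c power_int_mult)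
      also have "\<dots> = (\<zeta> ^ m) powi c" using m(2) \<zeta> by (simp add: torsion_char_powi[OF \<phi>(1) G])
      finally show ?thesis by (simp add: c power_int_mult)
    qed
    ultimately obtain \<psi> where \<psi>: "torsion_char (adjoin G g) \<psi>"
      "\<And>x e. x \<in> G \<Longrightarrow> \<psi> (x * g powi e) = \<phi> x * \<zeta> powi e"
      using torsion_char_adjoin[OF G \<phi>(1) g] by blast
    have \<psi>G: "\<psi> x = \<phi> x" if "x \<in> G" for x using \<psi>(2)[OF that, of 0] by simp
    have "\<psi> x \<noteq> 1" if "x \<in> A" for x
    proof (cases "root_of_unity x")
      case True
      then have "x \<in> A'" "x \<in> G" using that T by (auto simp: A'_def)
      then show ?thesis using \<psi>G \<phi>(2) by auto
    next
      case False
      then have "x ^ m \<in> A'" using that by (auto simp: A'_def)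
      then have "\<psi> (x ^ m) \<noteq> 1" using \<psi>G[OF pow[OF that]] \<phi>(2) by auto
      then show ?thesis
        using torsion_char_power[OF \<psi>(1) mult_subgroup_adjoin(1)[OF G g], of x m] that A(2) by auto
    qed
    then show ?thesis using \<psi>(1) \<psi>G \<phi>(3) T by (intro exI[of _ \<psi>]) auto
  qed
qed

text \<open>The induction starts with the group of all roots of unity, where the embedding
  \<open>to_ac\<close> is a separating character, and adjoins the elements of \<open>S\<close> one
  by one.\<close>

theorem finite_set_in_separated_subgroup:
  fixes S :: "'a::field_char_0 set"
  assumes "finite S" "0 \<notin> S"
  obtains G where "mult_subgroup G" "S \<subseteq> G" "separated_by_torsion_chars G"
proof -
  have "\<exists>G. mult_subgroup G \<and> {x. root_of_unity x} \<subseteq> G \<and> S \<subseteq> G \<and> separated_by_torsion_chars G"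
    using assms
  proof (induction S)
    case empty
    have "root_of_unity (to_ac x)" if "root_of_unity x" for x :: 'a
      using that by (auto simp: root_of_unity_def simp flip: to_ac_power)
    moreover have "1 \<notin> to_ac ` A" if "1 \<notin> A" for A :: "'a set"
      using that to_ac_1 to_ac_eq_iff by (metis imageE)
    ultimately have "separated_by_torsion_chars {x :: 'a. root_of_unity x}"
      unfolding separated_by_torsion_chars_def torsion_char_def
      by (intro allI impI exI[of _ to_ac]) simp
    then show ?case using mult_subgroup_roots_of_unity by blast
  next
    case (insert g S)
    then obtain G where G: "mult_subgroup G" "{x. root_of_unity x} \<subseteq> G" "S \<subseteq> G"
      "separated_by_torsion_chars G" by auto
    have "g \<noteq> 0" using insert.prems by auto
    with G show ?case
      using mult_subgroup_adjoin[OF G(1)] adjoin_superset[of G g]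
        separated_by_torsion_chars_adjoin[OF G(1,2,4)]
      by (intro exI[of _ "adjoin G g"]) auto
  qed
  then show ?thesis using that by blast
qed

section \<open>Graded representations of the quantum double\<close>

lemma bicharacterD:
  assumes "bicharacter chi"
  shows "chi x y \<noteq> 0" "chi (x + x') y = chi x y * chi x' y" "chi x (y + y') = chi x y * chi x y'"
    "chi 0 y = 1" "chi x 0 = 1"
  using assms by (auto simp: bicharacter_def)

lemma bicharacter_minus:
  assumes "bicharacter chi"
  shows "chi (- x) y = inverse (chi x y)" "chi x (- y) = inverse (chi x y)"
proof -
  note D = bicharacterD[OF assms]
  have "chi (- x) y * chi x y = 1" "chi x (- y) * chi x y = 1"
    using D(2)[of "- x" x y] D(3)[of x "- y" y] D(4,5) by simp_all
  then show "chi (- x) y = inverse (chi x y)" "chi x (- y) = inverse (chi x y)"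
    by (metis inverse_unique mult.commute)+
qed

lemma bicharacter_diff:
  assumes "bicharacter chi"
  shows "chi (x - x') y = chi x y / chi x' y" "chi x (y - y') = chi x y / chi x y'"
  using bicharacterD(2,3)[OF assms] bicharacter_minus[OF assms]
  by (simp_all add: diff_conv_add_uminus field_class.field_divide_inverse del: add_uminus_conv_diff)

lemma bicharacter_scale_nat:
  assumes "bicharacter chi"
  shows "chi (int n *s x) y = chi x y ^ n" "chi x (int n *s y) = chi x y ^ n"
  by (induction n)
    (simp_all add: int_vec.scale_left_distrib bicharacterD[OF assms])

lemma bicharacter_swap: "bicharacter chi \<Longrightarrow> bicharacter (\<lambda>x y. chi y x)"
  by (simp add: bicharacter_def)

text \<open>The q-integer, written as a sum so that it makes sense at \<open>q = 1\<close>
  too.\<close>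

definition qnum :: "'k::field \<Rightarrow> nat \<Rightarrow> 'k" where
  "qnum q n = (\<Sum>s<n. q ^ s)"

lemma qnum_simps [simp]: "qnum q 0 = 0" "qnum q (Suc n) = qnum q n + q ^ n"
  by (simp_all add: qnum_def)

lemma qnum_eq_0_iff: "q \<noteq> 1 \<Longrightarrow> qnum q n = 0 \<longleftrightarrow> q ^ n = 1"
proof -
  assume "q \<noteq> 1"
  moreover have "(q - 1) * qnum q n = q ^ n - 1"
    by (induction n) (simp_all add: algebra_simps)
  ultimately show ?thesis by (metis eq_iff_diff_eq_0 mult_eq_0_iff)
qed

text \<open>Multiplication by \<open>q ^ n\<close> reverses the geometric sum. This relates the
  q-integers in \<open>inverse q\<close>, which come from \<open>lw\<close>, to those in
  \<open>q\<close>, which come from \<open>kw\<close>.\<close>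

lemma qnum_inverse: "q \<noteq> 0 \<Longrightarrow> q ^ n * qnum (inverse q) (Suc n) = qnum q (Suc n)"
proof (induction n)
  case (Suc n)
  have "q ^ Suc n * qnum (inverse q) (Suc (Suc n)) =
    q * (q ^ n * qnum (inverse q) (Suc n)) + 1"
    using Suc.prems by (simp add: algebra_simps power_inverse)
  also have "\<dots> = q * qnum q (Suc n) + 1" using Suc by simp
  also have "q * qnum q k + 1 = qnum q (Suc k)" for k
    by (induction k) (simp_all add: algebra_simps)
  finally show ?case .
qed simp

text \<open>Iterated q-commutator with \<open>y\<close>. The twist gains a factor \<open>q\<close>
  at each stage because \<open>y\<close> then passes one more copy of itself.\<close>

primrec twisted_ad ::
  "('k::field \<Rightarrow> 'v::ab_group_add \<Rightarrow> 'v) \<Rightarrow> 'k \<Rightarrow> 'k \<Rightarrow> ('v \<Rightarrow> 'v) \<Rightarrow> ('v \<Rightarrow> 'v) \<Rightarrow> nat \<Rightarrow> 'v \<Rightarrow> 'v"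
where
  "twisted_ad sc q r y z 0 = z"
| "twisted_ad sc q r y z (Suc m) =
    (\<lambda>x. y (twisted_ad sc q r y z m x) - sc (q ^ m * r) (twisted_ad sc q r y z m (y x)))"

text \<open>
  \<open>kw \<beta> \<mu>\<close> and \<open>lw \<beta> \<mu>\<close> below are the eigenvalues on \<open>V \<mu>\<close> of the group-like elements \<open>K\<^sub>\<beta>\<close> and \<open>L\<^sub>\<beta>\<close>
  of the double; the characters \<open>a\<close> and \<open>b\<close> play the role of the highest weight. The sum of the
  \<open>V \<mu>\<close> is neither required to be direct nor to be everything; \<open>weight_op\<close> makes
  weight-dependent rescalings available as linear operators.
\<close>

locale graded_space = vector_space sc
  for sc :: "'k::field \<Rightarrow> 'v::ab_group_add \<Rightarrow> 'v" (infixr "\<cdot>" 75) +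
  fixes chi :: "int ^ 'n::finite \<Rightarrow> int ^ 'n \<Rightarrow> 'k"
    and a b :: "int ^ 'n \<Rightarrow> 'k"
    and V :: "int ^ 'n \<Rightarrow> 'v set"
  assumes chi: "bicharacter chi"
    and a_add: "a (x + y) = a x * a y" and a_nz: "a x \<noteq> 0"
    and b_add: "b (x + y) = b x * b y" and b_nz: "b x \<noteq> 0"
    and V_subspace: "subspace (V \<mu>)"
    and weight_op: "\<exists>T. Vector_Spaces.linear sc sc T \<and> (\<forall>\<mu>. \<forall>x\<in>V \<mu>. T x = \<phi> \<mu> \<cdot> x)"
begin

definition kw :: "int ^ 'n \<Rightarrow> int ^ 'n \<Rightarrow> 'k" where
  "kw \<beta> \<mu> = a \<beta> * chi \<beta> \<mu>"

definition lw :: "int ^ 'n \<Rightarrow> int ^ 'n \<Rightarrow> 'k" where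
  "lw \<beta> \<mu> = b \<beta> * inverse (chi \<mu> \<beta>)"

lemmas chiD = bicharacterD[OF chi] bicharacter_minus[OF chi] bicharacter_diff[OF chi]
  bicharacter_scale_nat[OF chi]

lemma kw_nz: "kw \<beta> \<mu> \<noteq> 0" and lw_nz: "lw \<beta> \<mu> \<noteq> 0"
  by (auto simp: kw_def lw_def a_nz b_nz chiD)

lemma kw_shift:
  "kw \<beta> (\<mu> + \<nu>) = kw \<beta> \<mu> * chi \<beta> \<nu>" "kw \<beta> (\<mu> - \<nu>) = kw \<beta> \<mu> * inverse (chi \<beta> \<nu>)"
  "lw \<beta> (\<mu> + \<nu>) = lw \<beta> \<mu> * inverse (chi \<nu> \<beta>)" "lw \<beta> (\<mu> - \<nu>) = lw \<beta> \<mu> * chi \<nu> \<beta>"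
  by (simp_all add: kw_def lw_def chiD field_class.field_divide_inverse)

lemma V_closed:
  "x \<in> V \<mu> \<Longrightarrow> y \<in> V \<mu> \<Longrightarrow> x + y \<in> V \<mu>" "x \<in> V \<mu> \<Longrightarrow> y \<in> V \<mu> \<Longrightarrow> x - y \<in> V \<mu>"
  "x \<in> V \<mu> \<Longrightarrow> c \<cdot> x \<in> V \<mu>" "0 \<in> V \<mu>"
  using V_subspace[of \<mu>] by (auto intro: subspace_add subspace_diff subspace_scale subspace_0)

lemma linear_simps:
  assumes "Vector_Spaces.linear sc sc g"
  shows "g (x + y) = g x + g y" "g (x - y) = g x - g y" "g (c \<cdot> x) = c \<cdot> g x" "g 0 = 0"
  using assms by (simp_all add: linear_iff_module_hom module_hom.add module_hom.diff
      module_hom.scale module_hom.zero)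

lemma linear_twisted:
  assumes "Vector_Spaces.linear sc sc g" "Vector_Spaces.linear sc sc h"
  shows "Vector_Spaces.linear sc sc (\<lambda>x. g (h x) - c \<cdot> h (g x))"
  by (simp add: Vector_Spaces.linear_iff vector_space_axioms linear_simps[OF assms(1)]
      linear_simps[OF assms(2)] scale_right_distrib scale_right_diff_distrib scale_left_commute)

text \<open>The group-like elements act on each \<open>V \<mu>\<close> by the scalars
  \<open>kw\<close> and \<open>lw\<close>, so only \<open>e\<close> and \<open>f\<close> appear as
  operators. The Serre relations are derived later from simplicity, in \<open>serre_e\<close> and
  \<open>serre_f\<close>.\<close>

definition double_rep :: "('n \<Rightarrow> int ^ 'n) \<Rightarrow> ('n \<Rightarrow> 'v \<Rightarrow> 'v) \<Rightarrow> ('n \<Rightarrow> 'v \<Rightarrow> 'v) \<Rightarrow> bool" where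
  "double_rep B e f \<longleftrightarrow>
     (\<forall>i. Vector_Spaces.linear sc sc (e i) \<and> Vector_Spaces.linear sc sc (f i)) \<and>
     (\<forall>i \<mu>. \<forall>x\<in>V \<mu>. e i x \<in> V (\<mu> + B i) \<and> f i x \<in> V (\<mu> - B i)) \<and>
     (\<forall>i j \<mu>. \<forall>x\<in>V \<mu>. e i (f j x) - f j (e i x) =
        (if i = j then (kw (B i) \<mu> - lw (B i) \<mu>) \<cdot> x else 0))"

end

locale weight_rep = graded_space sc chi a b V
  for sc :: "'k::field \<Rightarrow> 'v::ab_group_add \<Rightarrow> 'v" (infixr "\<cdot>" 75)
    and chi :: "int ^ 'n::finite \<Rightarrow> int ^ 'n \<Rightarrow> 'k"
    and a b V +
  fixes B :: "'n \<Rightarrow> int ^ 'n" and e f :: "'n \<Rightarrow> 'v \<Rightarrow> 'v"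
  assumes rep: "double_rep B e f"
begin

lemma e_lin: "Vector_Spaces.linear sc sc (e j)" and f_lin: "Vector_Spaces.linear sc sc (f j)"
  using rep by (auto simp: double_rep_def)

lemmas e_simps = linear_simps[OF e_lin]
lemmas f_simps = linear_simps[OF f_lin]

lemma e_deg: "x \<in> V \<mu> \<Longrightarrow> e j x \<in> V (\<mu> + B j)" and f_deg: "x \<in> V \<mu> \<Longrightarrow> f j x \<in> V (\<mu> - B j)"
  using rep by (auto simp: double_rep_def)

lemma ef: "x \<in> V \<mu> \<Longrightarrow> e j (f j x) = f j (e j x) + (kw (B j) \<mu> - lw (B j) \<mu>) \<cdot> x"
  using rep by (simp add: double_rep_def algebra_simps)

lemma ef_neq: "x \<in> V \<mu> \<Longrightarrow> j \<noteq> k \<Longrightarrow> e j (f k x) = f k (e j x)"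
  using rep unfolding double_rep_def by (metis eq_iff_diff_eq_0)

end

locale reflected_rep = weight_rep sc chi a b V B e f
  for sc :: "'k::field \<Rightarrow> 'v::ab_group_add \<Rightarrow> 'v" (infixr "\<cdot>" 75)
    and chi :: "int ^ 'n::finite \<Rightarrow> int ^ 'n \<Rightarrow> 'k"
    and a b V B e f +
  fixes i :: 'n
begin

text \<open>\<open>E j m\<close> is \<open>(ad e\<^sub>i)\<^sup>m(e\<^sub>j)\<close> for the adjoint action of the double, and \<open>F j m\<close> its counterpart.\<close>

abbreviation q where "q \<equiv> chi (B i) (B i)"
abbreviation p where "p j \<equiv> chi (B i) (B j) * chi (B j) (B i)"
abbreviation E where "E j m \<equiv> twisted_ad sc q (chi (B i) (B j)) (e i) (e j) m"
abbreviation F where "F j m \<equiv> twisted_ad sc q (chi (B j) (B i)) (f i) (f j) m"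

lemma E_lin: "Vector_Spaces.linear sc sc (E j m)"
  by (induction m) (simp_all add: e_lin linear_twisted)

lemma F_lin: "Vector_Spaces.linear sc sc (F j m)"
  by (induction m) (simp_all add: f_lin linear_twisted)

lemmas E_simps = linear_simps[OF E_lin]
lemmas F_simps = linear_simps[OF F_lin]

lemma E_deg: "x \<in> V \<mu> \<Longrightarrow> E j m x \<in> V (\<mu> + B j + int m *s B i)"
proof (induction m arbitrary: x \<mu>)
  case 0
  then show ?case using e_deg by simp
next
  case (Suc m)
  have "\<mu> + B j + int m *s B i + B i = \<mu> + B j + int (Suc m) *s B i"
    "\<mu> + B i + B j + int m *s B i = \<mu> + B j + int (Suc m) *s B i"
    by (simp_all add: int_vec.scale_left_distrib)
  then show ?case
    using e_deg[OF Suc.IH[OF Suc.prems], of i] Suc.IH[OF e_deg[OF Suc.prems, of i]]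
    by (metis twisted_ad.simps(2) V_closed(2,3))
qed

lemma F_deg: "x \<in> V \<mu> \<Longrightarrow> F j m x \<in> V (\<mu> - B j - int m *s B i)"
proof (induction m arbitrary: x \<mu>)
  case 0
  then show ?case using f_deg by simp
next
  case (Suc m)
  have "\<mu> - B j - int m *s B i - B i = \<mu> - B j - int (Suc m) *s B i"
    "\<mu> - B i - B j - int m *s B i = \<mu> - B j - int (Suc m) *s B i"
    by (simp_all add: int_vec.scale_left_distrib)
  then show ?case
    using f_deg[OF Suc.IH[OF Suc.prems], of i] Suc.IH[OF f_deg[OF Suc.prems, of i]]
    by (metis twisted_ad.simps(2) V_closed(2,3))
qed

lemma epow_deg: "x \<in> V \<mu> \<Longrightarrow> (e j ^^ n) x \<in> V (\<mu> + int n *s B j)"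
proof (induction n)
  case (Suc n)
  then show ?case using e_deg[OF Suc.IH[OF Suc.prems], of j]
    by (simp add: int_vec.scale_left_distrib add_ac)
qed simp

section \<open>Commutators of the iterated root vectors with the generators\<close>

definition \<gamma> :: "'n \<Rightarrow> nat \<Rightarrow> 'k" where
  "\<gamma> j m = (\<Sum>s<m. q ^ s * chi (B i) (B j) - inverse (q ^ s * chi (B j) (B i)))"

text \<open>Commuting \<open>f i\<close> past \<open>E j m\<close> strips off one
  \<open>e i\<close>; every stage of the q-commutator contributes one summand of
  \<open>\<gamma> j m\<close>. For \<open>m = 0\<close> the truncated index \<open>m - 1\<close> is
  harmless because \<open>\<gamma> j 0 = 0\<close>.\<close>

lemma E_fi:
  assumes "j \<noteq> i" "x \<in> V \<mu>"
  shows "E j m (f i x) = f i (E j m x) + (\<gamma> j m * lw (B i) \<mu>) \<cdot> E j (m - 1) x"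
  using assms(2)
proof (induction m arbitrary: x \<mu>)
  case 0
  then show ?case using ef_neq assms(1) by (simp add: \<gamma>_def)
next
  case (Suc m)
  let ?r = "q ^ m * chi (B i) (B j)"
  let ?K = "kw (B i) \<mu>" and ?L = "lw (B i) \<mu>"
  have 1: "e i (E j m (f i x)) = f i (e i (E j m x)) +
      (kw (B i) (\<mu> + B j + int m *s B i) - lw (B i) (\<mu> + B j + int m *s B i)) \<cdot> E j m x +
      (\<gamma> j m * ?L) \<cdot> e i (E j (m - 1) x)"
    using Suc.IH[OF Suc.prems] ef[OF E_deg[OF Suc.prems, of j m], of i] by (simp add: e_simps)
  have 2: "E j m (e i (f i x)) = f i (E j m (e i x)) +
      (\<gamma> j m * lw (B i) (\<mu> + B i)) \<cdot> E j (m - 1) (e i x) + (?K - ?L) \<cdot> E j m x"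
    using Suc.IH[OF e_deg[OF Suc.prems, of i]] ef[OF Suc.prems, of i] by (simp add: E_simps)
  \<comment> \<open>Shifting the weight by \<open>B i\<close> divides \<open>lw (B i)\<close> by
    \<open>q\<close>, which turns the twist \<open>?r\<close> into the one defining
    \<open>E j m\<close>; the difference is then a multiple of \<open>E j m x\<close> again.\<close>
  have 3: "(\<gamma> j m * ?L) \<cdot> e i (E j (m - 1) x) -
      ?r \<cdot> ((\<gamma> j m * lw (B i) (\<mu> + B i)) \<cdot> E j (m - 1) (e i x)) = (\<gamma> j m * ?L) \<cdot> E j m x"
    by (cases m) (simp_all add: \<gamma>_def kw_shift chiD scale_right_diff_distrib field_simps)
  have 4: "kw (B i) (\<mu> + B j + int m *s B i) - lw (B i) (\<mu> + B j + int m *s B i) - ?r * (?K - ?L)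
      = (?r - inverse (q ^ m * chi (B j) (B i))) * ?L"
    by (simp add: kw_shift chiD algebra_simps)
  have "E j (Suc m) (f i x) - f i (E j (Suc m) x) =
      (kw (B i) (\<mu> + B j + int m *s B i) - lw (B i) (\<mu> + B j + int m *s B i) - ?r * (?K - ?L)) \<cdot> E j m x
      + ((\<gamma> j m * ?L) \<cdot> e i (E j (m - 1) x) -
      ?r \<cdot> ((\<gamma> j m * lw (B i) (\<mu> + B i)) \<cdot> E j (m - 1) (e i x)))"
    by (simp only: twisted_ad.simps 1 2 f_simps scale_right_distrib scale_left_diff_distrib scale_scale)
      (simp add: algebra_simps)
  also have "\<dots> = (\<gamma> j (Suc m) * ?L) \<cdot> E j m x"
    unfolding 3 4 scale_left_distrib[symmetric] by (simp add: \<gamma>_def algebra_simps)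
  finally show ?case by (simp add: algebra_simps)
qed

lemma E_fk:
  assumes "k \<noteq> i" "k \<noteq> j" "x \<in> V \<mu>"
  shows "E j m (f k x) = f k (E j m x)"
  using assms(3)
proof (induction m arbitrary: x \<mu>)
  case 0
  then show ?case using ef_neq assms by simp
next
  case (Suc m)
  have "e i (E j m (f k x)) = f k (e i (E j m x))"
    using Suc.IH[OF Suc.prems] ef_neq[OF E_deg[OF Suc.prems, of j m], of i k] assms(1) by simp
  moreover have "E j m (e i (f k x)) = f k (E j m (e i x))"
    using Suc.IH[OF e_deg[OF Suc.prems, of i]] ef_neq[OF Suc.prems, of i k] assms(1) by simp
  ultimately show ?case by (simp add: f_simps)
qed

text \<open>The scalars \<open>kw - lw\<close> along the string of powers of \<open>e i\<close> add
  up to q-integers. Hence for \<open>q \<noteq> 1\<close> and \<open>q ^ n = 1\<close> the operator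
  \<open>e i ^^ n\<close> commutes with \<open>f i\<close> on weight vectors.\<close>

lemma epow_fi:
  assumes "x \<in> V \<mu>"
  shows "(e i ^^ n) (f i x) = f i ((e i ^^ n) x) +
    (qnum q n * kw (B i) \<mu> - qnum (inverse q) n * lw (B i) \<mu>) \<cdot> (e i ^^ (n - 1)) x"
proof (induction n)
  case (Suc n)
  let ?c = "\<lambda>n. qnum q n * kw (B i) \<mu> - qnum (inverse q) n * lw (B i) \<mu>"
  have "e i ((e i ^^ n) (f i x)) = e i (f i ((e i ^^ n) x)) + ?c n \<cdot> e i ((e i ^^ (n - 1)) x)"
    using Suc by (simp add: e_simps)
  also have "?c n \<cdot> e i ((e i ^^ (n - 1)) x) = ?c n \<cdot> (e i ^^ n) x"
    by (cases n) simp_all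
  also have "e i (f i ((e i ^^ n) x)) = f i (e i ((e i ^^ n) x)) +
     (kw (B i) \<mu> * q ^ n - lw (B i) \<mu> * inverse q ^ n) \<cdot> (e i ^^ n) x"
    using ef[OF epow_deg[OF assms], of i n i] by (simp add: kw_shift chiD power_inverse)
  finally show ?case
    by (simp add: algebra_simps flip: scale_left_distrib)
qed simp

lemma epow_fk:
  assumes "k \<noteq> i" "x \<in> V \<mu>"
  shows "(e i ^^ n) (f k x) = f k ((e i ^^ n) x)"
proof (induction n)
  case (Suc n)
  then show ?case using ef_neq[OF epow_deg[OF assms(2), of n i], of i k] assms(1) by simp
qed simp

section \<open>Commutators of the iterated root vectors with each other\<close>

definition EF_coeff :: "'n \<Rightarrow> nat \<Rightarrow> nat \<Rightarrow> 'k" where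
  "EF_coeff j m l = (- 1) ^ l * (\<Prod>s<m. 1 - q ^ s * p j) * (\<Prod>s<l. qnum q (m - s))"

text \<open>The commutator of \<open>E j m\<close> and \<open>F j l\<close> for
  \<open>l \<le> m\<close>, as \<open>E_F\<close> shows. If \<open>l < m\<close>, then
  \<open>m - l\<close> copies of \<open>e i\<close> are left over and only the \<open>kw\<close>
  part survives.\<close>

definition EF_comm :: "'n \<Rightarrow> nat \<Rightarrow> nat \<Rightarrow> int ^ 'n \<Rightarrow> 'v \<Rightarrow> 'v" where
  "EF_comm j m l \<mu> x = EF_coeff j m l \<cdot> (if m = l
     then (kw (B i) \<mu> ^ l * kw (B j) \<mu> - lw (B i) \<mu> ^ l * lw (B j) \<mu>) \<cdot> x
     else (kw (B i) \<mu> ^ l * kw (B j) \<mu>) \<cdot> (e i ^^ (m - l)) x)"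

text \<open>The twist of the first stage undoes the shift of \<open>lw (B j)\<close> under
  \<open>e i\<close>, so the \<open>lw\<close> parts cancel and for \<open>m > 0\<close> only the
  \<open>kw\<close> part remains.\<close>

lemma E_fj:
  assumes "j \<noteq> i" "x \<in> V \<mu>"
  shows "E j m (f j x) = f j (E j m x) + EF_comm j m 0 \<mu> x"
  using assms(2)
proof (induction m arbitrary: x \<mu>)
  case 0
  then show ?case using ef by (simp add: EF_comm_def EF_coeff_def)
next
  case (Suc m)
  let ?r = "q ^ m * chi (B i) (B j)"
  have "E j (Suc m) (f j x) - f j (E j (Suc m) x) = e i (EF_comm j m 0 \<mu> x) - ?r \<cdot> EF_comm j m 0 (\<mu> + B i) (e i x)"
    using Suc.IH[OF Suc.prems] Suc.IH[OF e_deg[OF Suc.prems, of i]] assms(1)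
      ef_neq[OF Suc.prems, of i j] ef_neq[OF E_deg[OF Suc.prems, of j m], of i j]
    by (simp add: e_simps f_simps scale_right_distrib)
  also have "\<dots> = EF_comm j (Suc m) 0 \<mu> x"
  proof (cases "m = 0")
    case True
    then show ?thesis
      by (simp add: EF_comm_def EF_coeff_def e_simps kw_shift chiD algebra_simps flip: scale_left_diff_distrib)
  next
    case False
    have "e i ((e i ^^ m) x) = (e i ^^ m) (e i x)"
      by (metis funpow_swap1)
    with False show ?thesis
      by (simp add: EF_comm_def EF_coeff_def e_simps kw_shift chiD algebra_simps flip: scale_left_diff_distrib)
  qed
  finally show ?case by (simp add: algebra_simps)
qed

text \<open>\<open>\<gamma>\<close> is a difference of two geometric sums, in \<open>q\<close> and
  in \<open>inverse q\<close>, and \<open>qnum_inverse\<close> gives them a common factor. For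
  \<open>q \<noteq> 1\<close> the last two factors vanish exactly under the two alternatives that
  define a reflection coefficient.\<close>

lemma \<gamma>_Suc:
  "\<gamma> j (Suc m) = - inverse (chi (B j) (B i)) * qnum (inverse q) (Suc m) * (1 - q ^ m * p j)"
proof (induction m)
  case 0
  then show ?case by (simp add: \<gamma>_def chiD field_simps)
next
  case (Suc m)
  \<comment> \<open>After this abstraction the induction step is a polynomial identity modulo the
    relations \<open>1\<close> and \<open>2\<close>.\<close>
  define Q x y u w z where defs: "Q = q ^ m" "x = chi (B i) (B j)" "y = chi (B j) (B i)"
    "u = inverse y" "w = qnum (inverse q) (Suc m)" "z = inverse q ^ Suc m"
  have "(q - 1) * qnum q n = q ^ n - 1" for n
    by (induction n) (simp_all add: algebra_simps)
  then have 1: "(q - 1) * (Q * w) = q * Q - 1"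
    using qnum_inverse[of q m] by (simp add: defs chiD del: qnum_simps)
  have 2: "y * u = 1" "z * (q * Q) = 1"
    by (simp_all add: defs chiD power_inverse del: power_Suc flip: power_Suc)
  have "\<gamma> j (Suc (Suc m)) = \<gamma> j (Suc m) + (q * Q * x - z * u)"
    by (simp add: \<gamma>_def defs power_inverse)
  also have "\<dots> = - u * w * (1 - Q * (x * y)) + (q * Q * x - z * u)"
    unfolding Suc defs by simp
  also have "\<dots> = - u * (w + z) * (1 - q * Q * (x * y))"
  proof -
    have "- u * (w + z) * (1 - q * Q * (x * y)) = - u * w * (1 - Q * (x * y)) + (q * Q * x - z * u)
        + (y * u) * x * ((q - 1) * (Q * w) + z * (q * Q)) - q * Q * x"
      by (simp add: algebra_simps)
    then show ?thesis unfolding 1 2 by (simp add: algebra_simps)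
  qed
  finally show ?case by (simp add: defs)
qed

lemma EF_coeff_Suc: "EF_coeff j m (Suc l) = - (qnum q (m - l) * EF_coeff j m l)"
  by (simp add: EF_coeff_def)

lemma EF_coeff_shift: "q ^ l * chi (B j) (B i) * \<gamma> j (Suc (l + n)) * EF_coeff j (l + n) l =
    - (qnum (inverse q) (Suc n) * EF_coeff j (Suc (l + n)) l)"
proof -
  have prod: "(\<Prod>s<l. qnum q (Suc (l + n) - s)) * qnum q (Suc n) =
      qnum q (Suc (l + n)) * (\<Prod>s<l. qnum q (l + n - s))"
  proof -
    have "(\<Prod>s<Suc l. qnum q (Suc (l + n) - s)) =
        qnum q (Suc (l + n)) * (\<Prod>s<l. qnum q (Suc (l + n) - Suc s))"
      by (subst prod.lessThan_Suc_shift) simp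
    then show ?thesis by (simp del: qnum_simps)
  qed
  \<comment> \<open>The factor \<open>q ^ n\<close>, on the left together with \<open>q ^ l\<close>,
    converts the q-integers in \<open>inverse q\<close> into q-integers in \<open>q\<close>, where
    the products match. It is cancelled at the end.\<close>
  have "q ^ n * (q ^ l * chi (B j) (B i) * \<gamma> j (Suc (l + n)) * EF_coeff j (l + n) l) =
      - (q ^ (l + n) * qnum (inverse q) (Suc (l + n))) * (1 - q ^ (l + n) * p j) * EF_coeff j (l + n) l"
    unfolding \<gamma>_Suc by (simp add: chiD power_add field_simps del: qnum_simps)
  also have "\<dots> = - (qnum q (Suc (l + n)) * (\<Prod>s<l. qnum q (l + n - s))) *
      ((- 1) ^ l * (\<Prod>s<Suc (l + n). 1 - q ^ s * p j))"
    using qnum_inverse[of q "l + n"] by (simp add: chiD EF_coeff_def del: qnum_simps)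
  also have "\<dots> = - (qnum q (Suc n) * EF_coeff j (Suc (l + n)) l)"
    unfolding prod[symmetric] by (simp add: EF_coeff_def mult_ac del: qnum_simps)
  also have "\<dots> = q ^ n * (- (qnum (inverse q) (Suc n) * EF_coeff j (Suc (l + n)) l))"
    using qnum_inverse[of q n] by (simp add: chiD del: qnum_simps flip: mult.assoc)
  finally show ?thesis
    by (rule mult_left_cancel[THEN iffD1, rotated]) (simp add: chiD)
qed

text \<open>The recursion that the remainder must satisfy when \<open>F j (Suc l)\<close> is
  expanded as a q-commutator. The first summand arises where \<open>E_fi\<close> lowers
  \<open>m\<close> by one.\<close>

lemma EF_comm_rec:
  assumes "l < m" "j \<noteq> i" "x \<in> V \<mu>"
  defines "r \<equiv> q ^ l * chi (B j) (B i)"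
  shows "(r * \<gamma> j m * lw (B i) \<mu>) \<cdot> EF_comm j (m - 1) l \<mu> x + f i (EF_comm j m l \<mu> x)
    - r \<cdot> EF_comm j m l (\<mu> - B i) (f i x) = EF_comm j m (Suc l) \<mu> x"
proof -
  obtain n where m: "m = Suc (l + n)" using less_imp_Suc_add[OF assms(1)] by blast
  let ?K = "kw (B i) \<mu>" and ?L = "lw (B i) \<mu>" and ?Kj = "kw (B j) \<mu>" and ?Lj = "lw (B j) \<mu>"
  let ?c = "EF_coeff j m l" and ?q' = "qnum (inverse q) (Suc n)"
  \<comment> \<open>\<open>r\<close> cancels the shift of \<open>kw (B i) ^ l * kw (B j)\<close>
    under \<open>f i\<close>, so the last two terms on the left combine to a commutator of
    \<open>f i\<close> with a power of \<open>e i\<close>.\<close>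
  have "r * (kw (B i) (\<mu> - B i) ^ l * kw (B j) (\<mu> - B i)) = ?K ^ l * ?Kj"
  proof -
    have "r * (inverse q ^ l * inverse (chi (B j) (B i))) =
        (q * inverse q) ^ l * (chi (B j) (B i) * inverse (chi (B j) (B i)))"
      by (simp only: r_def power_mult_distrib mult_ac)
    also have "\<dots> = 1" by (simp add: chiD)
    finally have "r * (inverse q ^ l * inverse (chi (B j) (B i))) = 1" .
    moreover have "r * (kw (B i) (\<mu> - B i) ^ l * kw (B j) (\<mu> - B i)) =
        r * (inverse q ^ l * inverse (chi (B j) (B i))) * (?K ^ l * ?Kj)"
      by (simp only: kw_shift power_mult_distrib mult_ac)
    ultimately show ?thesis by (simp only: mult_1)
  qed
  then have "f i (EF_comm j m l \<mu> x) - r \<cdot> EF_comm j m l (\<mu> - B i) (f i x) =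
      (?c * (?K ^ l * ?Kj)) \<cdot> (f i ((e i ^^ Suc n) x) - (e i ^^ Suc n) (f i x))"
    by (simp add: EF_comm_def m f_simps scale_right_diff_distrib mult_ac)
  also have "\<dots> = - ((?c * (?K ^ l * ?Kj) * (qnum q (Suc n) * ?K - ?q' * ?L)) \<cdot> (e i ^^ n) x)"
    using epow_fi[OF assms(3), of "Suc n"] by (simp del: funpow.simps qnum_simps)
  finally have 1: "f i (EF_comm j m l \<mu> x) - r \<cdot> EF_comm j m l (\<mu> - B i) (f i x) =
     - ((?c * (?K ^ l * ?Kj) * (qnum q (Suc n) * ?K - ?q' * ?L)) \<cdot> (e i ^^ n) x)" .
  have "r * \<gamma> j m * EF_coeff j (l + n) l = - (?q' * ?c)"
    unfolding r_def m by (rule EF_coeff_shift)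
  then have s: "(r * \<gamma> j m * ?L) \<cdot> EF_coeff j (l + n) l \<cdot> y = (- (?q' * ?c * ?L)) \<cdot> y" for y
  proof -
    have "(r * \<gamma> j m * ?L) \<cdot> EF_coeff j (l + n) l \<cdot> y = (r * \<gamma> j m * EF_coeff j (l + n) l * ?L) \<cdot> y"
      by (simp add: mult_ac)
    also have "\<dots> = (- (?q' * ?c * ?L)) \<cdot> y"
      unfolding \<open>r * \<gamma> j m * EF_coeff j (l + n) l = - (?q' * ?c)\<close> by simp
    finally show ?thesis .
  qed
  have 2: "(r * \<gamma> j m * ?L) \<cdot> EF_comm j (m - 1) l \<mu> x = (- (?q' * ?c * ?L)) \<cdot>
     (if n = 0 then (?K ^ l * ?Kj - ?L ^ l * ?Lj) \<cdot> x else (?K ^ l * ?Kj) \<cdot> (e i ^^ n) x)"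
    unfolding s[symmetric] by (simp add: EF_comm_def m)
  have 3: "EF_comm j m (Suc l) \<mu> x = (- (qnum q (Suc n) * ?c)) \<cdot>
     (if n = 0 then (?K ^ Suc l * ?Kj - ?L ^ Suc l * ?Lj) \<cdot> x else (?K ^ Suc l * ?Kj) \<cdot> (e i ^^ n) x)"
    by (simp add: EF_comm_def m EF_coeff_Suc del: qnum_simps)
  have "qnum z (Suc 0) = 1" for z :: 'k by simp
  then show ?thesis
    unfolding add_diff_eq[symmetric] 1 2 3
    by (cases "n = 0") (simp_all add: algebra_simps del: qnum_simps)
qed

text \<open>The reflected relations use \<open>l = m\<close>. General \<open>l\<close> carries the
  induction, in which \<open>m\<close> has to vary because \<open>E_fi\<close> replaces
  \<open>m\<close> by \<open>m - 1\<close>.\<close>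

lemma E_F:
  assumes "j \<noteq> i" "x \<in> V \<mu>" "l \<le> m"
  shows "E j m (F j l x) = F j l (E j m x) + EF_comm j m l \<mu> x"
  using assms(2,3)
proof (induction l arbitrary: m x \<mu>)
  case 0
  then show ?case using E_fj[OF assms(1)] by simp
next
  case (Suc l)
  let ?r = "q ^ l * chi (B j) (B i)"
  have le: "l \<le> m" "l \<le> m - 1" "l < m" using Suc.prems(2) by auto
  have "lw (B i) (\<mu> - B j - int l *s B i) = ?r * lw (B i) \<mu>"
    by (simp add: kw_shift chiD)
  then have 1: "E j m (f i (F j l x)) = f i (F j l (E j m x)) + f i (EF_comm j m l \<mu> x)
      + (?r * \<gamma> j m * lw (B i) \<mu>) \<cdot> (F j l (E j (m - 1) x) + EF_comm j (m - 1) l \<mu> x)"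
    using E_fi[OF assms(1) F_deg[OF Suc.prems(1)]] Suc.IH[OF Suc.prems(1)] le
    by (simp add: f_simps mult_ac)
  have 2: "E j m (F j l (f i x)) = F j l (f i (E j m x))
      + (\<gamma> j m * lw (B i) \<mu>) \<cdot> F j l (E j (m - 1) x) + EF_comm j m l (\<mu> - B i) (f i x)"
    using E_fi[OF assms(1) Suc.prems(1), of m] Suc.IH[OF f_deg[OF Suc.prems(1), of i] le(1)]
    by (simp add: F_simps)
  show ?case
    unfolding EF_comm_rec[OF le(3) assms(1) Suc.prems(1), symmetric]
    by (simp add: E_simps 1 2 scale_right_distrib scale_right_diff_distrib)
qed

lemma E_F_neq:
  assumes "j \<noteq> i" "k \<noteq> i" "j \<noteq> k" "x \<in> V \<mu>"
  shows "E j m (F k l x) = F k l (E j m x)"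
  using assms(4)
proof (induction l arbitrary: m x \<mu>)
  case 0
  then show ?case using E_fk assms(2,3) by simp
next
  case (Suc l)
  let ?r = "q ^ l * chi (B k) (B i)"
  have "lw (B i) (\<mu> - B k - int l *s B i) = ?r * lw (B i) \<mu>"
    by (simp add: kw_shift chiD)
  then have 1: "E j m (f i (F k l x)) = f i (F k l (E j m x)) + (?r * \<gamma> j m * lw (B i) \<mu>) \<cdot> F k l (E j (m - 1) x)"
    using E_fi[OF assms(1) F_deg[OF Suc.prems(1)]] Suc.IH[OF Suc.prems(1)] by (simp add: mult_ac)
  have 2: "E j m (F k l (f i x)) = F k l (f i (E j m x)) + (\<gamma> j m * lw (B i) \<mu>) \<cdot> F k l (E j (m - 1) x)"
    using E_fi[OF assms(1) Suc.prems(1), of m] Suc.IH[OF f_deg[OF Suc.prems(1), of i]]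
    by (simp add: F_simps)
  show ?case
    by (simp add: E_simps 1 2 scale_right_distrib scale_right_diff_distrib)
qed

end

section \<open>Highest weight representations\<close>

definition independent_family :: "('n::finite \<Rightarrow> int ^ 'n) \<Rightarrow> bool" where
  "independent_family B \<longleftrightarrow> (\<forall>c. (\<Sum>k\<in>UNIV. c k *s B k) = 0 \<longrightarrow> (\<forall>k. c k = 0))"

definition word_degree :: "('n::finite \<Rightarrow> int ^ 'n) \<Rightarrow> 'n list \<Rightarrow> int ^ 'n" where
  "word_degree B w = sum_list (map B w)"

lemma word_degree_simps [simp]:
  "word_degree B [] = 0" "word_degree B (k # w) = B k + word_degree B w"
  "word_degree B (u @ w) = word_degree B u + word_degree B w"
  by (simp_all add: word_degree_def)

lemma sum_indicator_scale:
  fixes B :: "'n::finite \<Rightarrow> int ^ 'n"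
  shows "(\<Sum>k\<in>UNIV. (if k = j then c else 0) *s B k) = c *s B j"
proof -
  have "(\<Sum>k\<in>UNIV. (if k = j then c else 0) *s B k) = (\<Sum>k\<in>UNIV. if k = j then c *s B k else 0)"
    by (intro sum.cong) auto
  then show ?thesis by simp
qed

lemma word_degree_eq_sum: "word_degree B w = (\<Sum>k\<in>UNIV. int (count_list w k) *s B k)"
proof (induction w)
  case (Cons j w)
  have "(\<Sum>k\<in>UNIV. int (count_list (j # w) k) *s B k) =
    (\<Sum>k\<in>UNIV. (if k = j then 1 else 0) *s B k + int (count_list w k) *s B k)"
    by (intro sum.cong) (auto simp: int_vec.scale_left_distrib)
  also have "\<dots> = B j + (\<Sum>k\<in>UNIV. int (count_list w k) *s B k)"
    unfolding sum.distrib sum_indicator_scale by simp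
  finally show ?case using Cons by simp
qed simp

text \<open>Letter counts are nonnegative, so a vector with a positive coordinate is never minus the
  degree of a word. This is how weights outside the support are recognized.\<close>

lemma neg_word_degree_neq:
  assumes "independent_family B" "c j > 0"
  shows "(\<Sum>k\<in>UNIV. c k *s B k) \<noteq> - word_degree B w"
proof
  assume "(\<Sum>k\<in>UNIV. c k *s B k) = - word_degree B w"
  then have "(\<Sum>k\<in>UNIV. (c k + int (count_list w k)) *s B k) = 0"
    by (simp add: int_vec.scale_left_distrib sum.distrib word_degree_eq_sum)
  then have "c j + int (count_list w j) = 0"
    using assms(1)[unfolded independent_family_def, rule_format, of "\<lambda>k. c k + int (count_list w k)"]
    by simp
  with assms(2) show False by simp
qed

lemma neg_word_degree_neq_add:
  assumes "independent_family B" "j \<noteq> i"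
  shows "B j + c *s B i \<noteq> - word_degree B w"
proof -
  have "(\<Sum>k\<in>UNIV. ((if k = j then 1 else 0) + (if k = i then c else 0)) *s B k) = B j + c *s B i"
    unfolding int_vec.scale_left_distrib sum.distrib sum_indicator_scale by simp
  then show ?thesis
    using neg_word_degree_neq[OF assms(1), of "\<lambda>k. (if k = j then 1 else 0) + (if k = i then c else 0)" j w] assms(2)
    by simp
qed

lemma neg_word_degree_neq_scale:
  assumes "independent_family B" "n > 0"
  shows "int n *s B i \<noteq> - word_degree B w"
  using neg_word_degree_neq[OF assms(1), of "\<lambda>k. if k = i then int n else 0" i w] assms(2)
  unfolding sum_indicator_scale by simp

context graded_space
begin

definition graded_subrep where
  "graded_subrep B e f N \<longleftrightarrow> (\<forall>\<mu>. subspace (N \<mu>) \<and> N \<mu> \<subseteq> V \<mu>) \<and>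
     (\<forall>i \<mu>. \<forall>x\<in>N \<mu>. e i x \<in> N (\<mu> + B i) \<and> f i x \<in> N (\<mu> - B i))"

definition simple_rep where
  "simple_rep B e f \<longleftrightarrow> (\<forall>N. graded_subrep B e f N \<longrightarrow> (\<forall>\<mu>. N \<mu> = {0}) \<or> N = V)"

definition highest_weight where
  "highest_weight e \<Lambda> v \<longleftrightarrow> v \<in> V \<Lambda> \<and> v \<noteq> 0 \<and> (\<forall>i. e i v = 0)"

end

context weight_rep
begin

lemma foldr_f_deg: "x \<in> V \<mu> \<Longrightarrow> foldr f w x \<in> V (\<mu> - word_degree B w)"
proof (induction w)
  case (Cons k w)
  then show ?case using f_deg[OF Cons.IH[OF Cons.prems], of k] by (simp add: algebra_simps)
qed simp

lemma foldr_f_zero: "foldr f w 0 = 0"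
  by (induction w) (simp_all add: f_simps)

definition generated :: "((int ^ 'n) \<times> 'v) set \<Rightarrow> int ^ 'n \<Rightarrow> 'v set" where
  "generated S \<mu> = span {foldr f w x | w x \<nu>. (\<nu>, x) \<in> S \<and> \<nu> - word_degree B w = \<mu>}"

lemma generatedI: "(\<nu>, x) \<in> S \<Longrightarrow> foldr f w x \<in> generated S (\<nu> - word_degree B w)"
  unfolding generated_def by (intro span_base) blast

text \<open>Triangularity: \<open>e k\<close> can be moved through a word in the \<open>f j\<close>
  at the cost of shorter words. So words in \<open>f\<close> suffice to generate a subrepresentation
  from a set that is stable under the \<open>e k\<close> up to zero.\<close>

lemma graded_subrep_generated:
  assumes S: "\<And>\<nu> x. (\<nu>, x) \<in> S \<Longrightarrow> x \<in> V \<nu>"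
    and e: "\<And>\<nu> x k. (\<nu>, x) \<in> S \<Longrightarrow> e k x = 0 \<or> (\<nu> + B k, e k x) \<in> S"
  shows "graded_subrep B e f (generated S)"
proof -
  have sub: "subspace (generated S \<mu>)" for \<mu> by (simp add: generated_def)
  have sub_V: "generated S \<mu> \<subseteq> V \<mu>" for \<mu>
    unfolding generated_def using V_subspace[of \<mu>] S by (intro span_minimal) (auto intro: foldr_f_deg)
  have extend: "g x \<in> generated S \<nu>"
    if "Vector_Spaces.linear sc sc g" "x \<in> generated S \<mu>"
      "\<And>w y \<nu>'. (\<nu>', y) \<in> S \<Longrightarrow> \<nu>' - word_degree B w = \<mu> \<Longrightarrow> g (foldr f w y) \<in> generated S \<nu>"
    for g x \<mu> \<nu>
  proof -
    have "subspace {x. g x \<in> generated S \<nu>}"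
      using sub[of \<nu>] linear_simps[OF that(1)]
      by (auto simp: subspace_def)
    then show ?thesis
      using that(2,3) unfolding generated_def[of S \<mu>]
      by (elim span_induct[where P = "\<lambda>x. g x \<in> generated S \<nu>"]) auto
  qed
  have f: "f k x \<in> generated S (\<mu> - B k)" if "x \<in> generated S \<mu>" for k x \<mu>
  proof (rule extend[OF f_lin that])
    fix w y \<nu>' assume "(\<nu>', y) \<in> S" "\<nu>' - word_degree B w = \<mu>"
    then show "f k (foldr f w y) \<in> generated S (\<mu> - B k)"
      using generatedI[of \<nu>' y S "k # w"] by (simp add: algebra_simps)
  qed
  have e': "e k (foldr f w y) \<in> generated S (\<nu> - word_degree B w + B k)" if "(\<nu>, y) \<in> S" for k w y \<nu>
  proof (induction w)
    case Nil
    show ?case using e[OF that, of k] generatedI[of "\<nu> + B k" "e k y" S "[]"] subspace_0[OF sub]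
      by auto
  next
    case (Cons j w)
    let ?y = "foldr f w y"
    have y: "?y \<in> V (\<nu> - word_degree B w)" by (rule foldr_f_deg[OF S[OF that]])
    have *: "\<nu> - word_degree B w + B k - B j = \<nu> - word_degree B (j # w) + B k"
      by (simp add: algebra_simps)
    have 1: "f j (e k ?y) \<in> generated S (\<nu> - word_degree B (j # w) + B k)"
      using f[OF Cons.IH, of j] unfolding * .
    show ?case
    proof (cases "k = j")
      case True
      have "\<nu> - word_degree B (j # w) + B k = \<nu> - word_degree B w" using True by simp
      then have "?y \<in> generated S (\<nu> - word_degree B (j # w) + B k)"
        using generatedI[OF that, of w] by simp
      then show ?thesis using ef[OF y, of j] 1 True sub
        by (simp add: subspace_add subspace_scale)
    next
      case False
      then show ?thesis using ef_neq[OF y, of k j] 1 by simp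
    qed
  qed
  have "e k x \<in> generated S (\<mu> + B k)" if "x \<in> generated S \<mu>" for k x \<mu>
    by (rule extend[OF e_lin that]) (use e' in auto)
  then show ?thesis
    using sub sub_V f by (auto simp: graded_subrep_def)
qed

end

locale highest_weight_rep = weight_rep sc chi a b V B e f
  for sc :: "'k::field \<Rightarrow> 'v::ab_group_add \<Rightarrow> 'v" (infixr "\<cdot>" 75)
    and chi :: "int ^ 'n::finite \<Rightarrow> int ^ 'n \<Rightarrow> 'k"
    and a b V B e f +
  fixes \<Lambda> :: "int ^ 'n" and v :: 'v
  assumes indep: "independent_family B"
    and simple: "simple_rep B e f"
    and hw: "highest_weight e \<Lambda> v"
begin

lemma v: "v \<in> V \<Lambda>" "v \<noteq> 0" "e i v = 0"
  using hw by (auto simp: highest_weight_def)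

lemma V_generated: "V = generated {(\<Lambda>, v)}"
proof -
  have "graded_subrep B e f (generated {(\<Lambda>, v)})"
    by (rule graded_subrep_generated) (auto simp: v)
  moreover have "v \<in> generated {(\<Lambda>, v)} \<Lambda>"
    using generatedI[of \<Lambda> v "{(\<Lambda>, v)}" "[]"] by simp
  ultimately show ?thesis
    using simple v(2) unfolding simple_rep_def by blast
qed

lemma support:
  assumes "x \<in> V \<mu>" "x \<noteq> 0"
  obtains w where "\<mu> = \<Lambda> - word_degree B w"
proof (rule ccontr)
  assume "\<not> thesis"
  then have "{foldr f w x | w x \<nu>. (\<nu>, x) \<in> {(\<Lambda>, v)} \<and> \<nu> - word_degree B w = \<mu>} = {}"
    using that by blast
  then have "V \<mu> = {0}"
    by (subst V_generated) (simp add: generated_def)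
  then show False using assms by auto
qed

text \<open>\<open>T\<close> is determined by \<open>T v\<close>, whose weight \<open>\<Lambda> + \<delta>\<close> does not occur.\<close>

lemma raising_commuting_zero:
  assumes lin: "Vector_Spaces.linear sc sc T" and deg: "\<And>\<mu> x. x \<in> V \<mu> \<Longrightarrow> T x \<in> V (\<mu> + \<delta>)"
    and comm: "\<And>k \<mu> x. x \<in> V \<mu> \<Longrightarrow> T (f k x) = f k (T x)"
    and \<delta>: "\<And>w. \<delta> \<noteq> - word_degree B w"
    and x: "x \<in> V \<mu>"
  shows "T x = 0"
proof -
  have "T v = 0"
  proof (rule ccontr)
    assume "T v \<noteq> 0"
    then obtain w where "\<Lambda> + \<delta> = \<Lambda> - word_degree B w"
      using support[OF deg[OF v(1)]] by blast
    with \<delta>[of w] show False by simp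
  qed
  have "T (foldr f w v) = foldr f w (T v)" for w
  proof (induction w)
    case (Cons k w)
    then show ?case using comm[OF foldr_f_deg[OF v(1), of w], of k] by simp
  qed simp
  then have "T (foldr f w v) = 0" for w by (simp add: \<open>T v = 0\<close> foldr_f_zero)
  moreover have "x \<in> span {foldr f w x | w x \<nu>. (\<nu>, x) \<in> {(\<Lambda>, v)} \<and> \<nu> - word_degree B w = \<mu>}"
    using x by (subst (asm) V_generated) (simp add: generated_def)
  ultimately show ?thesis
    by (elim module_hom.eq_0_on_span[OF lin[unfolded linear_iff_module_hom], rotated]) auto
qed

text \<open>The image of \<open>T\<close> generates a subrepresentation that misses the weight \<open>\<Lambda>\<close>.\<close>

lemma lowering_commuting_zero:
  assumes lin: "Vector_Spaces.linear sc sc T" and deg: "\<And>\<mu> x. x \<in> V \<mu> \<Longrightarrow> T x \<in> V (\<mu> - \<delta>)"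
    and comm: "\<And>k \<mu> x. x \<in> V \<mu> \<Longrightarrow> T (e k x) = e k (T x)"
    and \<delta>: "\<And>w. \<delta> \<noteq> - word_degree B w"
    and x: "x \<in> V \<mu>"
  shows "T x = 0"
proof -
  \<comment> \<open>\<open>T\<close> commutes with the \<open>e k\<close>, so its image is stable
    under them and \<open>graded_subrep_generated\<close> applies.\<close>
  define S where "S = {(\<nu> - \<delta>, T y) | \<nu> y. y \<in> V \<nu>}"
  have sub: "graded_subrep B e f (generated S)"
  proof (rule graded_subrep_generated)
    show "y \<in> V \<nu>" if "(\<nu>, y) \<in> S" for \<nu> y
      using that deg by (auto simp: S_def)
    show "e k y = 0 \<or> (\<nu> + B k, e k y) \<in> S" if S: "(\<nu>, y) \<in> S" for \<nu> y k
    proof -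
      obtain \<mu> z where z: "\<nu> = \<mu> - \<delta>" "y = T z" "z \<in> V \<mu>" using S by (auto simp: S_def)
      then have "e k y = T (e k z)" "\<nu> + B k = \<mu> + B k - \<delta>"
        using comm by (simp_all add: algebra_simps)
      with e_deg[OF z(3), of k] show ?thesis by (auto simp: S_def)
    qed
  qed
  have "foldr f w y = 0" if S: "(\<nu>, y) \<in> S" "\<nu> - word_degree B w = \<Lambda>" for w y \<nu>
  proof -
    obtain \<mu> z where z: "\<nu> = \<mu> - \<delta>" "y = T z" "z \<in> V \<mu>" using S by (auto simp: S_def)
    have "z = 0"
    proof (rule ccontr)
      assume "z \<noteq> 0"
      with z(3) obtain u where "\<mu> = \<Lambda> - word_degree B u" using support by blast
      then have "\<Lambda> - (word_degree B u + \<delta> + word_degree B w) = \<Lambda>"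
        using z(1) S(2) by (simp add: diff_diff_eq)
      then have "\<delta> = - word_degree B (u @ w)" by (simp add: eq_neg_iff_add_eq_0 add_ac)
      with \<delta> show False by blast
    qed
    then show ?thesis using z(2) linear_simps(4)[OF lin] by (simp add: foldr_f_zero)
  qed
  then have "generated S \<Lambda> \<subseteq> {0}"
    unfolding generated_def by (intro span_minimal) auto
  then have "generated S \<noteq> V" using v(1,2) by auto
  then have "generated S \<mu> = {0}" for \<mu>
    using simple sub unfolding simple_rep_def by blast
  moreover have "T x \<in> generated S (\<mu> - \<delta>)"
    using generatedI[of "\<mu> - \<delta>" "T x" S "[]"] x by (auto simp: S_def)
  ultimately show ?thesis by auto
qed

end

section \<open>Serre relations at a vertex of finite order\<close>

context graded_space
begin

text \<open>Exchanging \<open>e\<close> and \<open>f\<close> and negating degrees turns every identity for \<open>E\<close> into one for \<open>F\<close>.\<close>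

lemma opposite: "graded_space sc (\<lambda>x y. chi y x) b a (\<lambda>\<mu>. V (- \<mu>))"
proof (unfold_locales)
  show "\<exists>T. Vector_Spaces.linear sc sc T \<and> (\<forall>\<mu>. \<forall>x\<in>V (- \<mu>). T x = \<phi> \<mu> \<cdot> x)" for \<phi>
  proof -
    obtain T where T: "Vector_Spaces.linear sc sc T" "\<And>\<mu> x. x \<in> V \<mu> \<Longrightarrow> T x = \<phi> (- \<mu>) \<cdot> x"
      using weight_op[of "\<lambda>\<mu>. \<phi> (- \<mu>)"] by blast
    then show ?thesis by (intro exI[of _ T]) auto
  qed
qed (simp_all add: bicharacter_swap chi a_add b_add a_nz b_nz V_subspace)

lemma kw_add: "kw (\<beta> + \<beta>') \<mu> = kw \<beta> \<mu> * kw \<beta>' \<mu>" and lw_add: "lw (\<beta> + \<beta>') \<mu> = lw \<beta> \<mu> * lw \<beta>' \<mu>"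
  by (simp_all add: kw_def lw_def a_add b_add chiD)

lemma kw_zero: "kw 0 \<mu> = 1" and lw_zero: "lw 0 \<mu> = 1"
proof -
  have "kw 0 \<mu> * kw 0 \<mu> = kw 0 \<mu>" "lw 0 \<mu> * lw 0 \<mu> = lw 0 \<mu>"
    using kw_add[of 0 0 \<mu>] lw_add[of 0 0 \<mu>] by simp_all
  then show "kw 0 \<mu> = 1" "lw 0 \<mu> = 1" using kw_nz[of 0 \<mu>] lw_nz[of 0 \<mu>] by simp_all
qed

lemma kw_minus: "kw (- \<beta>) \<mu> = inverse (kw \<beta> \<mu>)" and lw_minus: "lw (- \<beta>) \<mu> = inverse (lw \<beta> \<mu>)"
proof -
  have "kw \<beta> \<mu> * kw (- \<beta>) \<mu> = 1" "lw \<beta> \<mu> * lw (- \<beta>) \<mu> = 1"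
    using kw_add[of \<beta> "- \<beta>" \<mu>] lw_add[of \<beta> "- \<beta>" \<mu>] by (simp_all add: kw_zero lw_zero)
  then show "kw (- \<beta>) \<mu> = inverse (kw \<beta> \<mu>)" "lw (- \<beta>) \<mu> = inverse (lw \<beta> \<mu>)"
    by (simp_all add: inverse_unique)
qed

lemma kw_scale_nat: "kw (int n *s \<beta>) \<mu> = kw \<beta> \<mu> ^ n" and lw_scale_nat: "lw (int n *s \<beta>) \<mu> = lw \<beta> \<mu> ^ n"
  by (induction n) (simp_all add: kw_zero lw_zero int_vec.scale_left_distrib kw_add lw_add)

lemma opposite_kw: "graded_space.kw (\<lambda>x y. chi y x) b \<beta> (- \<mu>) = lw \<beta> \<mu>"
  and opposite_lw: "graded_space.lw (\<lambda>x y. chi y x) a \<beta> (- \<mu>) = kw \<beta> \<mu>"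
  by (simp_all add: graded_space.kw_def[OF opposite] graded_space.lw_def[OF opposite]
      kw_def lw_def chiD)

end

context reflected_rep
begin

lemma opposite_rep: "reflected_rep sc (\<lambda>x y. chi y x) b a (\<lambda>\<mu>. V (- \<mu>)) B f e"
proof -
  interpret opp: graded_space sc "\<lambda>x y. chi y x" b a "\<lambda>\<mu>. V (- \<mu>)"
    by (rule opposite)
  have "opp.double_rep B f e"
    unfolding opp.double_rep_def
  proof (intro conjI allI ballI)
    fix j k \<mu> x assume x: "x \<in> V (- \<mu>)"
    have w: "opp.kw (B k) \<mu> = lw (B k) (- \<mu>)" "opp.lw (B k) \<mu> = kw (B k) (- \<mu>)"
      using opposite_kw[of "B k" "- \<mu>"] opposite_lw[of "B k" "- \<mu>"] by simp_all
    show "f j x \<in> V (- (\<mu> + B j))" "e j x \<in> V (- (\<mu> - B j))"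
      using f_deg[OF x, of j] e_deg[OF x, of j] by (simp_all add: algebra_simps)
    show "f j (e k x) - e k (f j x) = (if j = k then (opp.kw (B j) \<mu> - opp.lw (B j) \<mu>) \<cdot> x else 0)"
      using ef[OF x, of k] ef_neq[OF x, of k j] w by (auto simp: algebra_simps)
  qed (simp_all add: e_lin f_lin)
  then show ?thesis by unfold_locales
qed

lemma F_ei:
  assumes "j \<noteq> i" "x \<in> V \<mu>"
  shows "F j (Suc m) (e i x) = e i (F j (Suc m) x) +
    (- inverse (chi (B i) (B j)) * qnum (inverse q) (Suc m) * (1 - q ^ m * p j) * kw (B i) \<mu>) \<cdot> F j m x"
proof -
  interpret opp: reflected_rep sc "\<lambda>x y. chi y x" b a "\<lambda>\<mu>. V (- \<mu>)" B f e i
    by (rule opposite_rep)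
  show ?thesis
    using opp.E_fi[OF assms(1), of x "- \<mu>" "Suc m"] assms(2)
    unfolding opp.\<gamma>_Suc opposite_lw by (simp add: mult.commute[of "chi (B j) (B i)"] del: twisted_ad.simps)
qed

lemma F_ek:
  assumes "k \<noteq> i" "k \<noteq> j" "x \<in> V \<mu>"
  shows "F j m (e k x) = e k (F j m x)"
proof -
  interpret opp: reflected_rep sc "\<lambda>x y. chi y x" b a "\<lambda>\<mu>. V (- \<mu>)" B f e i
    by (rule opposite_rep)
  show ?thesis using opp.E_fk[OF assms(1,2), of x "- \<mu>"] assms(3) by simp
qed

lemma F_ej:
  assumes "j \<noteq> i" "x \<in> V \<mu>"
  shows "F j (Suc m) (e j x) = e j (F j (Suc m) x) +
    (\<Prod>s<Suc m. 1 - q ^ s * p j) \<cdot> lw (B j) \<mu> \<cdot> (f i ^^ Suc m) x"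
proof -
  interpret opp: reflected_rep sc "\<lambda>x y. chi y x" b a "\<lambda>\<mu>. V (- \<mu>)" B f e i
    by (rule opposite_rep)
  show ?thesis using opp.E_fj[OF assms(1), of x "- \<mu>" "Suc m"] assms(2)
    unfolding opp.EF_comm_def opp.EF_coeff_def opposite_kw
    by (simp add: mult.commute[of "chi (B j) (B i)"] del: twisted_ad.simps funpow.simps prod.lessThan_Suc)
qed

lemma fpow_ei:
  assumes "x \<in> V \<mu>" "qnum q n = 0" "qnum (inverse q) n = 0"
  shows "(f i ^^ n) (e i x) = e i ((f i ^^ n) x)"
proof -
  interpret opp: reflected_rep sc "\<lambda>x y. chi y x" b a "\<lambda>\<mu>. V (- \<mu>)" B f e i
    by (rule opposite_rep)
  show ?thesis using opp.epow_fi[of x "- \<mu>" n] assms by simp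
qed

lemma fpow_ek:
  assumes "k \<noteq> i" "x \<in> V \<mu>"
  shows "(f i ^^ n) (e k x) = e k ((f i ^^ n) x)"
proof -
  interpret opp: reflected_rep sc "\<lambda>x y. chi y x" b a "\<lambda>\<mu>. V (- \<mu>)" B f e i
    by (rule opposite_rep)
  show ?thesis using opp.epow_fk[OF assms(1), of x "- \<mu>" n] assms(2) by simp
qed

lemma fpow_deg: "x \<in> V \<mu> \<Longrightarrow> (f i ^^ n) x \<in> V (\<mu> - int n *s B i)"
proof (induction n)
  case (Suc n)
  then show ?case using f_deg[OF Suc.IH[OF Suc.prems], of i]
    by (simp add: int_vec.scale_left_distrib algebra_simps)
qed simp

lemma epow_lin: "Vector_Spaces.linear sc sc (e i ^^ n)" and fpow_lin: "Vector_Spaces.linear sc sc (f i ^^ n)"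
  by (induction n) (auto simp: Vector_Spaces.linear_iff vector_space_axioms e_simps f_simps)

end

text \<open>The exponents \<open>m\<close> are a parameter because in the application they are
  computed from the original bicharacter, while the module belongs to its specialization.
  \<open>m_vanish\<close> yields the Serre relations; \<open>m_min\<close> makes the scalars in the
  reflection invertible.\<close>

locale reflection_step = highest_weight_rep sc chi a b V B e f \<Lambda> v +
    reflected_rep sc chi a b V B e f i
  for sc :: "'k::field \<Rightarrow> 'v::ab_group_add \<Rightarrow> 'v" (infixr "\<cdot>" 75)
    and chi :: "int ^ 'n::finite \<Rightarrow> int ^ 'n \<Rightarrow> 'k"
    and a b V B e f \<Lambda> v i +
  fixes m :: "'n \<Rightarrow> nat"
  assumes q_neq: "chi (B i) (B i) \<noteq> 1" and q_root: "\<exists>n>0. chi (B i) (B i) ^ n = 1"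
    and m_vanish: "\<And>j. j \<noteq> i \<Longrightarrow> chi (B i) (B i) ^ m j * (chi (B i) (B j) * chi (B j) (B i)) = 1 \<or>
      chi (B i) (B i) ^ Suc (m j) = 1"
    and m_min: "\<And>j s. j \<noteq> i \<Longrightarrow> s < m j \<Longrightarrow>
      chi (B i) (B i) ^ s * (chi (B i) (B j) * chi (B j) (B i)) \<noteq> 1 \<and> chi (B i) (B i) ^ Suc s \<noteq> 1"
begin

lemma q'_neq: "inverse q \<noteq> 1"
  using q_neq by (metis inverse_1 inverse_inverse_eq)

lemma qnum_zero:
  "q ^ n = 1 \<Longrightarrow> qnum q n = 0" "q ^ n = 1 \<Longrightarrow> qnum (inverse q) n = 0"
  using qnum_eq_0_iff[OF q_neq, of n] qnum_eq_0_iff[OF q'_neq, of n] by (simp_all add: power_inverse)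

text \<open>The q-integers in \<open>epow_fi\<close> vanish, so \<open>e i ^^ n\<close> commutes
  with every \<open>f k\<close>; as it raises weights, \<open>raising_commuting_zero\<close>
  applies.\<close>

lemma epow_zero:
  assumes "q ^ n = 1" "n > 0" "x \<in> V \<mu>"
  shows "(e i ^^ n) x = 0"
proof (rule raising_commuting_zero[OF epow_lin _ _ _ assms(3)])
  show "(e i ^^ n) y \<in> V (\<nu> + int n *s B i)" if "y \<in> V \<nu>" for y \<nu> using epow_deg[OF that] .
  show "(e i ^^ n) (f k y) = f k ((e i ^^ n) y)" if "y \<in> V \<nu>" for k y \<nu>
    using epow_fi[OF that, of n] epow_fk[OF _ that, of k n] qnum_zero[OF assms(1)] by (cases "k = i") auto
  show "int n *s B i \<noteq> - word_degree B w" for w using neg_word_degree_neq_scale[OF indep assms(2)] .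
qed

lemma fpow_zero:
  assumes "q ^ n = 1" "n > 0" "x \<in> V \<mu>"
  shows "(f i ^^ n) x = 0"
proof (rule lowering_commuting_zero[OF fpow_lin _ _ _ assms(3)])
  show "(f i ^^ n) y \<in> V (\<nu> - int n *s B i)" if "y \<in> V \<nu>" for y \<nu> using fpow_deg[OF that] .
  show "(f i ^^ n) (e k y) = e k ((f i ^^ n) y)" if "y \<in> V \<nu>" for k y \<nu>
    using fpow_ei[OF that, of n] fpow_ek[OF _ that, of k n] qnum_zero[OF assms(1)] by (cases "k = i") auto
  show "int n *s B i \<noteq> - word_degree B w" for w using neg_word_degree_neq_scale[OF indep assms(2)] .
qed

text \<open>In the second identity the alternatives of \<open>m_vanish\<close> act differently: one
  kills a factor of the product, the other a power of \<open>e i\<close> or \<open>f i\<close>. The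
  \<open>if\<close> stands for the vanishing of that power.\<close>

lemma coeff_zero:
  assumes "j \<noteq> i"
  shows "qnum (inverse q) (Suc (m j)) * (1 - q ^ m j * p j) = 0"
    "(\<Prod>s<Suc (m j). 1 - q ^ s * p j) \<cdot> c \<cdot> (if q ^ Suc (m j) = 1 then 0 else y) = 0"
proof -
  show "qnum (inverse q) (Suc (m j)) * (1 - q ^ m j * p j) = 0"
    using m_vanish[OF assms] qnum_zero(2)[of "Suc (m j)"] by (auto simp del: qnum_simps)
  show "(\<Prod>s<Suc (m j). 1 - q ^ s * p j) \<cdot> c \<cdot> (if q ^ Suc (m j) = 1 then 0 else y) = 0"
    using m_vanish[OF assms] by auto
qed

lemma coeff_nz:
  assumes "j \<noteq> i" "n < m j"
  shows "qnum (inverse q) (Suc n) * (1 - q ^ n * p j) \<noteq> 0"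
  using m_min[OF assms] qnum_eq_0_iff[OF q'_neq, of "Suc n"]
  by (auto simp: power_inverse simp del: qnum_simps power_Suc)

text \<open>By \<open>coeff_zero\<close>, \<open>E j (Suc (m j))\<close> commutes with every
  \<open>f k\<close>, hence is zero on weight vectors; the relation is this zero with its outermost
  q-commutator expanded.\<close>

lemma serre_e:
  assumes "j \<noteq> i" "x \<in> V \<mu>"
  shows "e i (E j (m j) x) = (q ^ m j * chi (B i) (B j)) \<cdot> E j (m j) (e i x)"
proof -
  have "E j (Suc (m j)) x = 0"
  proof (rule raising_commuting_zero[OF E_lin _ _ _ assms(2)])
    show "E j (Suc (m j)) y \<in> V (\<nu> + (B j + int (Suc (m j)) *s B i))" if "y \<in> V \<nu>" for y \<nu>
      using E_deg[OF that, of j "Suc (m j)"] by (simp only: add.assoc)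
    show "B j + int (Suc (m j)) *s B i \<noteq> - word_degree B w" for w
      by (rule neg_word_degree_neq_add[OF indep assms(1)])
    show "E j (Suc (m j)) (f k y) = f k (E j (Suc (m j)) y)" if y: "y \<in> V \<nu>" for k y \<nu>
    proof -
      consider "k = i" | "k = j" | "k \<noteq> i" "k \<noteq> j" by blast
      then show ?thesis
      proof cases
        case 1
        have "\<gamma> j (Suc (m j)) = 0" unfolding \<gamma>_Suc using coeff_zero(1)[OF assms(1)]
          by (simp del: qnum_simps)
        then show ?thesis using E_fi[OF assms(1) y, of "Suc (m j)"] 1 by (simp del: twisted_ad.simps)
      next
        case 2
        have "EF_comm j (Suc (m j)) 0 \<nu> y = 0"
          using coeff_zero(2)[OF assms(1), of "kw (B j) \<nu>" "(e i ^^ Suc (m j)) y"]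
            epow_zero[OF _ _ y, of "Suc (m j)"]
          unfolding EF_comm_def EF_coeff_def by (cases "q ^ Suc (m j) = 1") (simp_all del: funpow.simps)
        then show ?thesis using E_fj[OF assms(1) y, of "Suc (m j)"] 2 by (simp del: twisted_ad.simps)
      next
        case 3
        then show ?thesis using E_fk y by blast
      qed
    qed
  qed
  then show ?thesis by simp
qed

lemma serre_f:
  assumes "j \<noteq> i" "x \<in> V \<mu>"
  shows "f i (F j (m j) x) = (q ^ m j * chi (B j) (B i)) \<cdot> F j (m j) (f i x)"
proof -
  have "F j (Suc (m j)) x = 0"
  proof (rule lowering_commuting_zero[OF F_lin _ _ _ assms(2)])
    show "F j (Suc (m j)) y \<in> V (\<nu> - (B j + int (Suc (m j)) *s B i))" if "y \<in> V \<nu>" for y \<nu>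
      using F_deg[OF that, of j "Suc (m j)"] by (simp only: diff_diff_eq)
    show "B j + int (Suc (m j)) *s B i \<noteq> - word_degree B w" for w
      by (rule neg_word_degree_neq_add[OF indep assms(1)])
    show "F j (Suc (m j)) (e k y) = e k (F j (Suc (m j)) y)" if y: "y \<in> V \<nu>" for k y \<nu>
    proof -
      consider "k = i" | "k = j" | "k \<noteq> i" "k \<noteq> j" by blast
      then show ?thesis
      proof cases
        case 1
        have "- inverse (chi (B i) (B j)) * qnum (inverse q) (Suc (m j)) * (1 - q ^ m j * p j) = 0"
          using coeff_zero(1)[OF assms(1)] by (simp del: qnum_simps)
        then show ?thesis using F_ei[OF assms(1) y, of "m j"] 1 by (simp del: twisted_ad.simps)
      next
        case 2
        have "(\<Prod>s<Suc (m j). 1 - q ^ s * p j) \<cdot> lw (B j) \<nu> \<cdot> (f i ^^ Suc (m j)) y = 0"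
          using coeff_zero(2)[OF assms(1), of "lw (B j) \<nu>" "(f i ^^ Suc (m j)) y"]
            fpow_zero[OF _ _ y, of "Suc (m j)"]
          by (cases "q ^ Suc (m j) = 1") (simp_all del: funpow.simps)
        then show ?thesis using F_ej[OF assms(1) y, of "m j"] 2 by (simp del: twisted_ad.simps)
      next
        case 3
        then show ?thesis using F_ek y by blast
      qed
    qed
  qed
  then show ?thesis by simp
qed

end

section \<open>Reflecting a highest weight representation\<close>

context reflection_step
begin

text \<open>Lusztig's isomorphism: \<open>e\<^sub>i \<mapsto> f\<^sub>i L\<^sub>i\<^sup>-\<^sup>1\<close>, \<open>f\<^sub>i \<mapsto> K\<^sub>i\<^sup>-\<^sup>1 e\<^sub>i\<close>, \<open>e\<^sub>j \<mapsto> (ad e\<^sub>i)\<^sup>m(e\<^sub>j)\<close> and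
  \<open>f\<^sub>j \<mapsto> c\<^sup>-\<^sup>1 (ad f\<^sub>i)\<^sup>m(f\<^sub>j)\<close> with \<open>m = m\<^sub>i\<^sub>j\<close>.\<close>

definition B' :: "'n \<Rightarrow> int ^ 'n" where
  "B' j = (if j = i then - B i else B j + int (m j) *s B i)"

text \<open>The operators of a \<open>double_rep\<close> are linear on the whole space, so the
  rescaling is taken from \<open>weight_op\<close>, which prescribes its values on the
  \<open>V \<mu>\<close>.\<close>

definition lw_inverse :: "'v \<Rightarrow> 'v" where
  "lw_inverse = (SOME T. Vector_Spaces.linear sc sc T \<and> (\<forall>\<mu>. \<forall>x\<in>V \<mu>. T x = inverse (lw (B i) \<mu>) \<cdot> x))"

definition kw_inverse :: "'v \<Rightarrow> 'v" where
  "kw_inverse = (SOME T. Vector_Spaces.linear sc sc T \<and> (\<forall>\<mu>. \<forall>x\<in>V \<mu>. T x = inverse (kw (B i) \<mu>) \<cdot> x))"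

definition e' :: "'n \<Rightarrow> 'v \<Rightarrow> 'v" where
  "e' j = (if j = i then f i \<circ> lw_inverse else E j (m j))"

definition f' :: "'n \<Rightarrow> 'v \<Rightarrow> 'v" where
  "f' j = (if j = i then kw_inverse \<circ> e i else (\<lambda>x. inverse (EF_coeff j (m j) (m j)) \<cdot> F j (m j) x))"

lemma lw_inverse: "Vector_Spaces.linear sc sc lw_inverse" "x \<in> V \<mu> \<Longrightarrow> lw_inverse x = inverse (lw (B i) \<mu>) \<cdot> x"
  using someI_ex[OF weight_op[of "\<lambda>\<mu>. inverse (lw (B i) \<mu>)"]] unfolding lw_inverse_def by blast+

lemma kw_inverse: "Vector_Spaces.linear sc sc kw_inverse" "x \<in> V \<mu> \<Longrightarrow> kw_inverse x = inverse (kw (B i) \<mu>) \<cdot> x"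
  using someI_ex[OF weight_op[of "\<lambda>\<mu>. inverse (kw (B i) \<mu>)"]] unfolding kw_inverse_def by blast+

lemma e'_i: "x \<in> V \<mu> \<Longrightarrow> e' i x = inverse (lw (B i) \<mu>) \<cdot> f i x"
  by (simp add: e'_def lw_inverse f_simps)

text \<open>The extra \<open>q\<close> appears because \<open>kw_inverse\<close> acts after
  \<open>e i\<close>, at weight \<open>\<mu> + B i\<close>.\<close>

lemma f'_i: "x \<in> V \<mu> \<Longrightarrow> f' i x = inverse (kw (B i) \<mu> * q) \<cdot> e i x"
  using kw_inverse(2)[OF e_deg[of x \<mu> i]] by (simp add: f'_def kw_shift)

lemma EF_coeff_nz: "j \<noteq> i \<Longrightarrow> EF_coeff j (m j) (m j) \<noteq> 0"
proof -
  assume j: "j \<noteq> i"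
  have "qnum q n \<noteq> 0" if "0 < n" "n \<le> m j" for n
    using m_min[OF j, of "n - 1"] qnum_eq_0_iff[OF q_neq, of n] that by simp
  then show ?thesis using m_min[OF j] by (auto simp: EF_coeff_def simp del: qnum_simps)
qed

lemma e'_deg: "x \<in> V \<mu> \<Longrightarrow> e' j x \<in> V (\<mu> + B' j)"
proof (cases "j = i")
  case True
  assume "x \<in> V \<mu>"
  then show ?thesis using f_deg[of x \<mu> i] True by (simp add: e'_i B'_def V_closed)
next
  case False
  assume "x \<in> V \<mu>"
  then show ?thesis using E_deg[of x \<mu> j "m j"] False by (simp add: e'_def B'_def add.assoc)
qed

lemma f'_deg: "x \<in> V \<mu> \<Longrightarrow> f' j x \<in> V (\<mu> - B' j)"
proof (cases "j = i")
  case True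
  assume "x \<in> V \<mu>"
  then show ?thesis using e_deg[of x \<mu> i] True by (simp add: f'_i B'_def V_closed)
next
  case False
  assume "x \<in> V \<mu>"
  then show ?thesis using F_deg[of x \<mu> j "m j"] False
    by (simp add: f'_def B'_def diff_diff_eq V_closed)
qed

lemma e'_lin: "Vector_Spaces.linear sc sc (e' j)" and f'_lin: "Vector_Spaces.linear sc sc (f' j)"
  using linear_simps[OF lw_inverse(1)] linear_simps[OF kw_inverse(1)]
  by (simp_all add: Vector_Spaces.linear_iff vector_space_axioms e'_def f'_def e_simps f_simps
      E_simps F_simps scale_right_distrib scale_left_commute)

text \<open>For \<open>j = k = i\<close>, rescaling turns the reversed commutator
  \<open>lw - kw\<close> into the difference for \<open>- B i\<close>. If exactly one index is
  \<open>i\<close>, the rescaling absorbs the scalar of the Serre relation. \<open>E_F\<close> and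
  \<open>E_F_neq\<close> settle the rest.\<close>

lemma e'_f'_commutator:
  assumes x: "x \<in> V \<mu>"
  shows "e' j (f' k x) - f' k (e' j x) =
    (if j = k then (kw (B' j) \<mu> - lw (B' j) \<mu>) \<cdot> x else 0)"
proof -
  let ?K = "kw (B i) \<mu>" and ?L = "lw (B i) \<mu>"
  note nz = kw_nz[of "B i" \<mu>] lw_nz[of "B i" \<mu>] chiD(1)
  consider "j = i" "k = i" | "j = i" "k \<noteq> i" | "j \<noteq> i" "k = i" | "j \<noteq> i" "k = j" | "j \<noteq> i" "k \<noteq> i" "j \<noteq> k"
    by blast
  then show ?thesis
  proof cases
    case 1
    have "e' i (f' i x) = inverse (?K * ?L) \<cdot> f i (e i x)"
      using e'_i[OF e_deg[OF x, of i]] linear_simps[OF e'_lin[of i]] nz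
      by (simp add: f'_i[OF x] kw_shift field_simps)
    moreover have "f' i (e' i x) = inverse (?K * ?L) \<cdot> e i (f i x)"
      using f'_i[OF f_deg[OF x, of i]] linear_simps[OF f'_lin[of i]] nz
      by (simp add: e'_i[OF x] kw_shift field_simps)
    ultimately have "e' i (f' i x) - f' i (e' i x) = (inverse (?K * ?L) * (?L - ?K)) \<cdot> x"
      using ef[OF x, of i] by (simp add: algebra_simps)
    also have "inverse (?K * ?L) * (?L - ?K) = inverse ?K - inverse ?L"
      using nz by (simp add: field_simps)
    finally show ?thesis using 1 by (simp add: B'_def kw_minus lw_minus)
  next
    case 2
    let ?c = "inverse (EF_coeff k (m k) (m k))"
    have "lw (B i) (\<mu> - (B k + int (m k) *s B i)) = ?L * (q ^ m k * chi (B k) (B i))"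
      by (simp add: kw_shift chiD)
    then have "e' i (F k (m k) x) = inverse (?L * (q ^ m k * chi (B k) (B i))) \<cdot> f i (F k (m k) x)"
      using e'_i[OF F_deg[OF x, of k "m k"]] by (simp add: diff_diff_eq)
    also have "\<dots> = inverse ?L \<cdot> F k (m k) (f i x)"
      unfolding serre_f[OF 2(2) x] scale_scale using nz by (simp add: field_simps)
    finally have "e' i (f' k x) = ?c \<cdot> inverse ?L \<cdot> F k (m k) (f i x)"
      using 2 linear_simps[OF e'_lin[of i]] by (simp add: f'_def)
    moreover have "f' k (e' i x) = ?c \<cdot> inverse ?L \<cdot> F k (m k) (f i x)"
      using 2 by (simp add: e'_i[OF x] f'_def F_simps)
    ultimately show ?thesis using 2 by simp
  next
    case 3
    have "e' j (f' i x) = inverse (?K * q) \<cdot> E j (m j) (e i x)"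
      using 3 linear_simps[OF e'_lin[of j]] by (simp add: f'_i[OF x]) (simp add: e'_def)
    moreover have "f' i (E j (m j) x) =
        inverse (?K * (q ^ m j * chi (B i) (B j)) * q) \<cdot> e i (E j (m j) x)"
      using f'_i[OF E_deg[OF x, of j "m j"]] by (simp add: kw_shift chiD mult_ac)
    then have "f' i (e' j x) = inverse (?K * q) \<cdot> E j (m j) (e i x)"
      unfolding serre_e[OF 3(1) x] scale_scale using 3 nz by (simp add: e'_def field_simps)
    ultimately show ?thesis using 3 by simp
  next
    case 4
    have "E j (m j) (F j (m j) x) = F j (m j) (E j (m j) x) + EF_comm j (m j) (m j) \<mu> x"
      using E_F[OF 4(1) x] by simp
    then show ?thesis using 4 EF_coeff_nz[of j]
      by (simp add: e'_def f'_def EF_comm_def E_simps B'_def kw_add lw_add kw_scale_nat lw_scale_nat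
          scale_right_distrib mult.commute)
  next
    case 5
    then show ?thesis using E_F_neq[OF 5 x] by (simp add: e'_def f'_def E_simps)
  qed
qed

lemma rep': "double_rep B' e' f'"
  unfolding double_rep_def using e'_lin f'_lin e'_deg f'_deg e'_f'_commutator by blast

lemma independent_B': "independent_family B'"
  unfolding independent_family_def
proof (intro allI impI)
  fix c :: "'n \<Rightarrow> int" and k
  assume c: "(\<Sum>j\<in>UNIV. c j *s B' j) = 0"
  \<comment> \<open>The total coefficient of \<open>B i\<close> after expanding the
    \<open>B' j\<close>, apart from which only the coefficients \<open>c j\<close> with
    \<open>j \<noteq> i\<close> remain.\<close>
  define d where "d = (\<Sum>j\<in>UNIV. if j = i then - c i else c j * int (m j))"
  have "c j *s B' j = (if j = i then 0 else c j) *s B j +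
      (if j = i then - c i else c j * int (m j)) *s B i" for j
    by (simp add: B'_def int_vec.scale_right_distrib)
  then have "(\<Sum>j\<in>UNIV. c j *s B' j) =
      (\<Sum>j\<in>UNIV. (if j = i then 0 else c j) *s B j) + (\<Sum>j\<in>UNIV. (if j = i then d else 0) *s B j)"
    unfolding sum_indicator_scale d_def by (simp add: sum.distrib flip: int_vec.scale_sum_left)
  then have "(\<Sum>j\<in>UNIV. ((if j = i then 0 else c j) + (if j = i then d else 0)) *s B j) = 0"
    using c by (simp add: int_vec.scale_left_distrib sum.distrib)
  then have *: "(if j = i then 0 else c j) + (if j = i then d else 0) = 0" for j
    using indep[unfolded independent_family_def, rule_format,
        of "\<lambda>j. (if j = i then 0 else c j) + (if j = i then d else 0)" j] by blast
  have neq: "c j = 0" if "j \<noteq> i" for j using *[of j] that by simp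
  then have "d = (\<Sum>j\<in>UNIV. if j = i then - c i else 0)"
    unfolding d_def by (intro sum.cong) auto
  then have "c i = 0" using *[of i] by simp
  then show "c k = 0" using neq by (cases "k = i") auto
qed

text \<open>The old generators are recovered from the new ones: \<open>e i\<close> and
  \<open>f i\<close> up to nonzero scalars, and \<open>e j\<close> by stripping the copies of
  \<open>e i\<close> off \<open>E j (m j)\<close> one at a time with \<open>f i\<close>; similarly
  for \<open>f j\<close>. Minimality of \<open>m j\<close> keeps the coefficients of this descent
  nonzero.\<close>

lemma subrep':
  assumes N: "graded_subrep B' e' f' N"
  shows "graded_subrep B e f N"
proof -
  have sub: "subspace (N \<mu>)" "N \<mu> \<subseteq> V \<mu>" for \<mu> using N by (auto simp: graded_subrep_def)
  have e'N: "e' j x \<in> N (\<mu> + B' j)" and f'N: "f' j x \<in> N (\<mu> - B' j)" if "x \<in> N \<mu>" for j x \<mu>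
    using N that by (auto simp: graded_subrep_def)
  have V: "x \<in> V \<mu>" if "x \<in> N \<mu>" for x \<mu> using sub that by blast
  have cancel: "x \<in> N \<mu>" if "c \<cdot> x \<in> N \<mu>" "c \<noteq> 0" for c x \<mu>
    using subspace_scale[OF sub(1) that(1), of "inverse c"] that(2) by simp
  have fi: "f i x \<in> N (\<mu> - B i)" if "x \<in> N \<mu>" for x \<mu>
  proof (rule cancel)
    show "inverse (lw (B i) \<mu>) \<cdot> f i x \<in> N (\<mu> - B i)"
      using e'N[OF that, of i] e'_i[OF V[OF that]] by (simp add: B'_def)
  qed (simp add: lw_nz)
  have ei: "e i x \<in> N (\<mu> + B i)" if "x \<in> N \<mu>" for x \<mu>
  proof (rule cancel)
    show "inverse (kw (B i) \<mu> * q) \<cdot> e i x \<in> N (\<mu> + B i)"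
      using f'N[OF that, of i] f'_i[OF V[OF that]] by (simp add: B'_def)
  qed (simp add: kw_nz chiD)
  have E: "E j n x \<in> N (\<mu> + (B j + int n *s B i))" if "j \<noteq> i" "n \<le> m j" "x \<in> N \<mu>" for j n x \<mu>
    using that(2,3)
  proof (induction n arbitrary: x \<mu> rule: inc_induct)
    case base
    then show ?case using e'N[of x \<mu> j] that(1) by (simp add: e'_def B'_def)
  next
    case (step n)
    have d: "\<mu> - B i + (B j + int (Suc n) *s B i) = \<mu> + (B j + int n *s B i)"
      "\<mu> + (B j + int (Suc n) *s B i) - B i = \<mu> + (B j + int n *s B i)"
      by (simp_all add: int_vec.scale_left_distrib)
    have "E j (Suc n) (f i x) - f i (E j (Suc n) x) \<in> N (\<mu> + (B j + int n *s B i))"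
      using step.IH[OF fi[OF step.prems]] fi[OF step.IH[OF step.prems]] subspace_diff[OF sub(1)]
      unfolding d by blast
    then have "(\<gamma> j (Suc n) * lw (B i) \<mu>) \<cdot> E j n x \<in> N (\<mu> + (B j + int n *s B i))"
      using E_fi[OF that(1) V[OF step.prems], of "Suc n"] by (simp del: twisted_ad.simps)
    moreover have "\<gamma> j (Suc n) \<noteq> 0"
      unfolding \<gamma>_Suc using coeff_nz[OF that(1) step.hyps(2)] by (simp add: chiD del: qnum_simps)
    ultimately show ?case using cancel lw_nz by simp
  qed
  have F: "F j n x \<in> N (\<mu> - (B j + int n *s B i))" if "j \<noteq> i" "n \<le> m j" "x \<in> N \<mu>" for j n x \<mu>
    using that(2,3)
  proof (induction n arbitrary: x \<mu> rule: inc_induct)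
    case base
    have "inverse (EF_coeff j (m j) (m j)) \<cdot> F j (m j) x \<in> N (\<mu> - (B j + int (m j) *s B i))"
      using f'N[OF base(1), of j] that(1) by (simp add: f'_def B'_def)
    then show ?case using cancel EF_coeff_nz[OF that(1)] by simp
  next
    case (step n)
    have d: "\<mu> + B i - (B j + int (Suc n) *s B i) = \<mu> - (B j + int n *s B i)"
      "\<mu> - (B j + int (Suc n) *s B i) + B i = \<mu> - (B j + int n *s B i)"
      by (simp_all add: int_vec.scale_left_distrib)
    have "F j (Suc n) (e i x) - e i (F j (Suc n) x) \<in> N (\<mu> - (B j + int n *s B i))"
      using step.IH[OF ei[OF step.prems]] ei[OF step.IH[OF step.prems]] subspace_diff[OF sub(1)]
      unfolding d by blast
    then have "(- inverse (chi (B i) (B j)) * qnum (inverse q) (Suc n) * (1 - q ^ n * p j) * kw (B i) \<mu>)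
        \<cdot> F j n x \<in> N (\<mu> - (B j + int n *s B i))"
      using F_ei[OF that(1) V[OF step.prems], of n] by (simp del: twisted_ad.simps qnum_simps)
    moreover have "- inverse (chi (B i) (B j)) * qnum (inverse q) (Suc n) * (1 - q ^ n * p j) * kw (B i) \<mu> \<noteq> 0"
      using coeff_nz[OF that(1) step.hyps(2)] by (simp add: chiD kw_nz del: qnum_simps)
    ultimately show ?case using cancel by blast
  qed
  have "e j x \<in> N (\<mu> + B j)" "f j x \<in> N (\<mu> - B j)" if "x \<in> N \<mu>" for j x \<mu>
    using E[of j 0 x \<mu>] F[of j 0 x \<mu>] ei[OF that] fi[OF that] that by (cases "j = i"; simp)+
  then show ?thesis using sub by (auto simp: graded_subrep_def)
qed

lemma simple': "simple_rep B' e' f'"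
  using simple subrep' unfolding simple_rep_def by blast

text \<open>The choice of \<open>M\<close> makes \<open>e' i\<close> vanish. For
  \<open>j \<noteq> i\<close> the image under \<open>e' j\<close> would have weight
  \<open>\<Lambda> + B j\<close> plus a multiple of \<open>B i\<close>, which lies outside the
  support.\<close>

lemma highest_weight':
  obtains \<Lambda>' v' where "highest_weight e' \<Lambda>' v'"
proof -
  obtain n where n: "n > 0" "q ^ n = 1" using q_root by blast
  then have "(f i ^^ n) v = 0" using fpow_zero v(1) by blast
  \<comment> \<open>Minimizing over \<open>Suc n\<close> makes \<open>M\<close> the exponent of the
    last nonzero power; for \<open>M = 0\<close> this is \<open>v \<noteq> 0\<close>.\<close>
  define M where "M = (LEAST n. (f i ^^ Suc n) v = 0)"
  have "(f i ^^ Suc (n - 1)) v = 0" using \<open>(f i ^^ n) v = 0\<close> n(1) by simp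
  then have M0: "(f i ^^ Suc M) v = 0" unfolding M_def by (rule LeastI)
  have M: "(f i ^^ M) v \<noteq> 0"
  proof (cases M)
    case (Suc M')
    then show ?thesis using not_less_Least[of M' "\<lambda>n. (f i ^^ Suc n) v = 0"] unfolding M_def by simp
  qed (simp add: v)
  have deg: "(f i ^^ M) v \<in> V (\<Lambda> - int M *s B i)" using fpow_deg[OF v(1)] .
  have "e' j ((f i ^^ M) v) = 0" for j
  proof (cases "j = i")
    case True
    then show ?thesis using e'_i[OF deg] M0 by simp
  next
    case False
    show ?thesis
    proof (rule ccontr)
      assume "e' j ((f i ^^ M) v) \<noteq> 0"
      with e'_deg[OF deg, of j] obtain w
        where "\<Lambda> - int M *s B i + B' j = \<Lambda> - word_degree B w" using support by blast
      then have "B j + (int (m j) - int M) *s B i = - word_degree B w"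
        using False by (simp add: B'_def int_vec.scale_left_diff_distrib algebra_simps)
      then show False using neg_word_degree_neq_add[OF indep False] by blast
    qed
  qed
  then have "highest_weight e' (\<Lambda> - int M *s B i) ((f i ^^ M) v)"
    using deg M by (simp add: highest_weight_def)
  then show ?thesis using that by blast
qed

lemma reflected_highest_weight_rep:
  obtains \<Lambda>' v' where "highest_weight_rep sc chi a b V B' e' f' \<Lambda>' v'"
proof -
  obtain \<Lambda>' v' where "highest_weight e' \<Lambda>' v'" by (rule highest_weight')
  then have "highest_weight_rep sc chi a b V B' e' f' \<Lambda>' v'"
    by unfold_locales (simp_all add: rep' independent_B' simple')
  then show ?thesis using that by blast
qed

end

section \<open>Existence of highest weight representations\<close>

definition fun_scale :: "'k::field \<Rightarrow> ('a \<Rightarrow> 'k) \<Rightarrow> 'a \<Rightarrow> 'k" where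
  "fun_scale c g = (\<lambda>u. c * g u)"

interpretation fun_space: vector_space "fun_scale :: 'k::field \<Rightarrow> ('a \<Rightarrow> 'k) \<Rightarrow> 'a \<Rightarrow> 'k"
  by unfold_locales (simp_all add: fun_scale_def fun_eq_iff algebra_simps)

text \<open>
  A functional on words is read as a vector \<open>g\<close> of a highest weight module through the values
  \<open>g [j\<^sub>1, \<dots>, j\<^sub>r]\<close> = coefficient of the highest weight vector in \<open>e\<^bsub>j\<^sub>1\<^esub> \<cdots> e\<^bsub>j\<^sub>r\<^esub> g\<close>; commuting
  \<open>f\<^sub>i\<close> to the left through such a product gives \<open>lower_at\<close>.
\<close>

primrec lower_at ::
  "('n \<Rightarrow> int ^ 'n) \<Rightarrow> (int ^ 'n \<Rightarrow> 'k::field) \<Rightarrow> 'n \<Rightarrow> 'n list \<Rightarrow> int ^ 'n \<Rightarrow> ('n list \<Rightarrow> 'k) \<Rightarrow> 'k"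
where
  "lower_at B \<kappa> i [] d g = 0"
| "lower_at B \<kappa> i (j # u) d g =
    (if j = i then \<kappa> (- d) * g u else 0) + lower_at B \<kappa> i u (d + B j) (\<lambda>w. g (j # w))"

text \<open>\<open>e j\<close> evaluates a functional on words extended by a final \<open>j\<close>,
  so for \<open>d = 0\<close> this is the commutator relation between \<open>e j\<close> and
  \<open>f i\<close>.\<close>

lemma lower_at_snoc:
  "lower_at B \<kappa> i (u @ [j]) d g = lower_at B \<kappa> i u d (\<lambda>w. g (w @ [j])) +
     (if j = i then \<kappa> (- (d + word_degree B u)) * g u else 0)"
  by (induction u arbitrary: d g) (simp_all add: add_ac)

lemma lower_at_add:
  "lower_at B \<kappa> i u d (\<lambda>w. g w + h w) = lower_at B \<kappa> i u d g + lower_at B \<kappa> i u d h"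
  by (induction u arbitrary: d g h) (simp_all add: algebra_simps)

lemma lower_at_scale: "lower_at B \<kappa> i u d (\<lambda>w. c * g w) = c * lower_at B \<kappa> i u d g"
  by (induction u arbitrary: d g) (simp_all add: algebra_simps)

lemma lower_at_nonzero:
  assumes "lower_at B \<kappa> i u d g \<noteq> 0"
  obtains w where "g w \<noteq> 0" "word_degree B u = word_degree B w + B i"
proof -
  have "\<exists>w. g w \<noteq> 0 \<and> word_degree B u = word_degree B w + B i"
    using assms
  proof (induction u arbitrary: d g)
    case (Cons j u)
    show ?case
    proof (cases "j = i \<and> g u \<noteq> 0")
      case True
      then show ?thesis by (intro exI[of _ u]) (simp add: add_ac)
    next
      case False
      then have "lower_at B \<kappa> i u (d + B j) (\<lambda>w. g (j # w)) \<noteq> 0" using Cons.prems by (auto split: if_splits)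
      from Cons.IH[OF this] obtain w where "g (j # w) \<noteq> 0" "word_degree B u = word_degree B w + B i"
        by blast
      then show ?thesis by (intro exI[of _ "j # w"]) (simp add: add_ac)
    qed
  qed simp
  then show ?thesis using that by blast
qed

text \<open>The module is generated by the indicator \<open>v\<close> of the empty word. Any nonzero
  graded element can be raised by operators \<open>e i\<close> to one that is nonzero at the empty
  word, and that one is a multiple of \<open>v\<close>; hence simplicity.\<close>

lemma highest_weight_rep_exists:
  fixes chi :: "int ^ 'n::finite \<Rightarrow> int ^ 'n \<Rightarrow> 'k::field"
  assumes chi: "bicharacter chi" and B: "independent_family B"
    and a: "\<And>x y. a (x + y) = a x * a y" "\<And>x. a x \<noteq> 0"
    and b: "\<And>x y. b (x + y) = b x * b y" "\<And>x. b x \<noteq> 0"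
  obtains V e f v where
    "highest_weight_rep (fun_scale :: 'k \<Rightarrow> ('n list \<Rightarrow> 'k) \<Rightarrow> 'n list \<Rightarrow> 'k) chi a b V B e f 0 v"
proof -
  \<comment> \<open>A functional of weight \<open>\<mu>\<close> sees only the words that raise
    \<open>\<mu>\<close> to the highest weight 0, whence the minus sign.\<close>
  define V :: "int ^ 'n \<Rightarrow> ('n list \<Rightarrow> 'k) set"
    where "V \<mu> = {g. \<forall>u. g u \<noteq> 0 \<longrightarrow> word_degree B u = - \<mu>}" for \<mu>
  have V_sub: "fun_space.subspace (V \<mu>)" for \<mu>
    by (auto simp: fun_space.subspace_def V_def fun_scale_def) (metis add_0)
  have V_weight: "\<exists>T. Vector_Spaces.linear fun_scale fun_scale T \<and> (\<forall>\<mu>. \<forall>x\<in>V \<mu>. T x = fun_scale (\<phi> \<mu>) x)" for \<phi>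
  proof (intro exI[of _ "\<lambda>g u. \<phi> (- word_degree B u) * g u"] conjI allI ballI)
    show "Vector_Spaces.linear fun_scale fun_scale (\<lambda>g u. \<phi> (- word_degree B u) * g u)"
      by (simp add: Vector_Spaces.linear_iff fun_space.vector_space_axioms fun_scale_def fun_eq_iff algebra_simps)
    show "(\<lambda>u. \<phi> (- word_degree B u) * x u) = fun_scale (\<phi> \<mu>) x" if "x \<in> V \<mu>" for x \<mu>
    proof
      show "\<phi> (- word_degree B u) * x u = fun_scale (\<phi> \<mu>) x u" for u
        using that by (cases "x u = 0") (auto simp: V_def fun_scale_def)
    qed
  qed
  interpret V: graded_space fun_scale chi a b V
    by unfold_locales (use chi a b V_sub V_weight in auto)
  define e :: "'n \<Rightarrow> ('n list \<Rightarrow> 'k) \<Rightarrow> 'n list \<Rightarrow> 'k" where "e i g = (\<lambda>u. g (u @ [i]))" for i g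
  define f :: "'n \<Rightarrow> ('n list \<Rightarrow> 'k) \<Rightarrow> 'n list \<Rightarrow> 'k"
    where "f i g = (\<lambda>u. lower_at B (\<lambda>\<mu>. V.kw (B i) \<mu> - V.lw (B i) \<mu>) i u 0 g)" for i g
  have "V.double_rep B e f"
    unfolding V.double_rep_def
  proof (intro conjI allI ballI)
    show "Vector_Spaces.linear fun_scale fun_scale (e i)" for i
      by (simp add: Vector_Spaces.linear_iff fun_space.vector_space_axioms fun_scale_def e_def fun_eq_iff)
    show "Vector_Spaces.linear fun_scale fun_scale (f i)" for i
      by (simp add: Vector_Spaces.linear_iff fun_space.vector_space_axioms f_def fun_eq_iff
          lower_at_add lower_at_scale fun_scale_def plus_fun_def)
    fix i j \<mu> x assume x: "x \<in> V \<mu>"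
    show "e i x \<in> V (\<mu> + B i)"
      using x by (auto simp: V_def e_def algebra_simps)
    show "f i x \<in> V (\<mu> - B i)"
      using x by (auto simp: V_def f_def elim!: lower_at_nonzero)
    show "e i (f j x) - f j (e i x) =
        (if i = j then fun_scale (V.kw (B i) \<mu> - V.lw (B i) \<mu>) x else 0)"
    proof
      fix u
      have "(e i (f j x) - f j (e i x)) u =
          (if i = j then (V.kw (B j) (- word_degree B u) - V.lw (B j) (- word_degree B u)) * x u else 0)"
        by (simp add: e_def f_def lower_at_snoc)
      then show "(e i (f j x) - f j (e i x)) u =
          (if i = j then fun_scale (V.kw (B i) \<mu> - V.lw (B i) \<mu>) x else 0) u"
        using x by (cases "x u = 0") (auto simp: V_def fun_scale_def)
    qed
  qed
  then interpret V: weight_rep fun_scale chi a b V B e f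
    by unfold_locales
  define v :: "'n list \<Rightarrow> 'k" where "v u = (if u = [] then 1 else 0)" for u
  define L where "L = V.generated {(0, v)}"
  have ev: "e k v = 0" for k by (simp add: e_def v_def fun_eq_iff)
  have vV: "v \<in> V 0" by (simp add: V_def v_def)
  have L: "V.graded_subrep B e f L"
    unfolding L_def by (rule V.graded_subrep_generated) (auto simp: ev vV)
  then have L_sub: "fun_space.subspace (L \<mu>)" "L \<mu> \<subseteq> V \<mu>" for \<mu>
    by (auto simp: V.graded_subrep_def)
  interpret L: graded_space fun_scale chi a b L
  proof unfold_locales
    show "\<exists>T. Vector_Spaces.linear fun_scale fun_scale T \<and> (\<forall>\<mu>. \<forall>x\<in>L \<mu>. T x = fun_scale (\<phi> \<mu>) x)" for \<phi>
      using V_weight[of \<phi>] L_sub(2) by blast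
  qed (use chi a b L_sub in auto)
  have rep: "L.double_rep B e f"
    using V.rep L L_sub(2) unfolding L.double_rep_def V.double_rep_def V.graded_subrep_def
    by (meson subsetD)
  have "v \<in> L 0" using V.generatedI[of 0 v "{(0, v)}" "[]"] by (simp add: L_def)
  moreover have "v \<noteq> 0" by (auto simp: v_def fun_eq_iff)
  ultimately have hw: "L.highest_weight e 0 v"
    by (simp add: L.highest_weight_def ev)
  have "L.simple_rep B e f"
    unfolding L.simple_rep_def
  proof (intro allI impI)
    fix N assume N: "L.graded_subrep B e f N"
    have N_sub: "fun_space.subspace (N \<mu>)" "N \<mu> \<subseteq> L \<mu>"
      and N_st: "x \<in> N \<mu> \<Longrightarrow> e i x \<in> N (\<mu> + B i)" "x \<in> N \<mu> \<Longrightarrow> f i x \<in> N (\<mu> - B i)" for \<mu> i x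
      using N by (auto simp: L.graded_subrep_def)
    show "(\<forall>\<mu>. N \<mu> = {0}) \<or> N = L"
    proof (rule disjCI)
      assume "\<not> N = L"
      have top: "\<exists>h \<nu>. h \<in> N \<nu> \<and> h [] \<noteq> 0" if "g \<in> N \<mu>" "g u \<noteq> 0" for g \<mu> u
        using that
      proof (induction u arbitrary: g \<mu> rule: rev_induct)
        case (snoc i u)
        then show ?case using N_st(1)[OF snoc.prems(1), of i] snoc.IH[of "e i g" "\<mu> + B i"]
          by (simp add: e_def)
      qed blast
      have "N \<mu> \<subseteq> {0}" for \<mu>
      proof (rule ccontr)
        assume "\<not> N \<mu> \<subseteq> {0}"
        then obtain g where "g \<in> N \<mu>" "g \<noteq> 0" by blast
        moreover then obtain u where "g u \<noteq> 0" by (auto simp: fun_eq_iff)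
        ultimately obtain h \<nu> where h: "h \<in> N \<nu>" "h [] \<noteq> 0" using top by blast
        then have hV: "h \<in> V \<nu>" using N_sub L_sub by blast
        then have "\<nu> = 0" using h(2) by (force simp: V_def)
        \<comment> \<open>\<open>h\<close> has weight 0, and by independence of \<open>B\<close> no
          nonempty word has degree 0.\<close>
        have "h u = 0" if "u \<noteq> []" for u
        proof (rule ccontr)
          assume "h u \<noteq> 0"
          then have "word_degree B u = 0" using hV \<open>\<nu> = 0\<close> by (simp add: V_def)
          then have "int (count_list u (hd u)) = 0"
            using B[unfolded independent_family_def, rule_format, of "\<lambda>k. int (count_list u k)"]
            by (simp add: word_degree_eq_sum)
          with that show False by (cases u) auto
        qed
        then have "h = fun_scale (h []) v" by (auto simp: fun_scale_def v_def fun_eq_iff)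
        then have "v = fun_scale (inverse (h [])) h"
          using h(2) by (metis fun_space.scale_scale fun_space.scale_one left_inverse)
        then have "v \<in> N 0"
          using fun_space.subspace_scale[OF N_sub(1) h(1), of "inverse (h [])"] \<open>\<nu> = 0\<close> by simp
        then have "foldr f w v \<in> N (0 - word_degree B w)" for w
        proof (induction w)
          case (Cons k w)
          have "0 - word_degree B w - B k = 0 - word_degree B (k # w)" by simp
          then show ?case using N_st(2)[OF Cons.IH[OF Cons.prems], of k] by (simp only: foldr.simps o_apply)
        qed simp
        then have "L \<mu> \<subseteq> N \<mu>" for \<mu>
          unfolding L_def V.generated_def using N_sub(1) by (intro fun_space.span_minimal) auto
        then have "N = L" using N_sub(2) by (intro ext) blast
        with \<open>\<not> N = L\<close> show False ..
      qed
      then show "\<forall>\<mu>. N \<mu> = {0}" using fun_space.subspace_0[OF N_sub(1)] by blast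
    qed
  qed
  then have "highest_weight_rep fun_scale chi a b L B e f 0 v"
    by unfold_locales (use rep B hw in auto)
  then show ?thesis using that by blast
qed

section \<open>Specialization and the root system\<close>

lemma ordered_basis_independent_family:
  fixes B :: "'n::finite \<Rightarrow> int ^ 'n"
  assumes "ordered_basis B"
  shows "independent_family B"
  unfolding independent_family_def
proof (intro allI impI)
  fix c :: "'n \<Rightarrow> int" and k
  assume c: "(\<Sum>k\<in>UNIV. c k *s B k) = 0"
  have inj: "inj B" and ind: "int_vec.independent (range B)"
    using assms by (auto simp: ordered_basis_def)
  have "(\<Sum>x\<in>range B. c (inv_into UNIV B x) *s x) = 0"
    using c by (simp add: sum.reindex[OF inj] inj)
  then have "c (inv_into UNIV B (B k)) = 0"
    using int_vec.independentD[OF ind, of "range B" "\<lambda>x. c (inv_into UNIV B x)" "B k"] by simp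
  then show "c k = 0" using inj by simp
qed

lemma reflection_apply:
  assumes "ordered_basis B"
  shows "(reflection chi B i \<circ> B) j =
    (if j = i then - B i else B j + int (refl_coeff chi B i j) *s B i)"
  by (auto simp: reflection_props[OF assms])

text \<open>All reflection coefficients between \<open>l\<close> and the other vertices vanish, in
  both directions: reflecting at \<open>l\<close> only negates \<open>B l\<close>, and the other
  reflections fix \<open>B l\<close>.\<close>

definition isolated :: "(int ^ 'n \<Rightarrow> int ^ 'n \<Rightarrow> 'k::field) \<Rightarrow> ('n \<Rightarrow> int ^ 'n) \<Rightarrow> 'n \<Rightarrow> bool" where
  "isolated chi B l \<longleftrightarrow> chi (B l) (B l) = 1 \<and> (\<forall>j. j \<noteq> l \<longrightarrow> chi (B l) (B j) * chi (B j) (B l) = 1)"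

text \<open>
  Reflections at vertices with \<open>\<chi>(e\<^sub>i, e\<^sub>i) = 1\<close> cannot be realized on a highest weight module, since
  \<open>f\<^sub>i\<close> need not be nilpotent there. They are skipped, which costs a sign at isolated vertices.
\<close>

definition equal_up_to_isolated ::
  "(int ^ 'n \<Rightarrow> int ^ 'n \<Rightarrow> 'k::field) \<Rightarrow> ('n \<Rightarrow> int ^ 'n) \<Rightarrow> ('n \<Rightarrow> int ^ 'n) \<Rightarrow> bool" where
  "equal_up_to_isolated chi B B' \<longleftrightarrow> (\<forall>l. B l = B' l \<or> isolated chi B l \<and> B l = - B' l)"

lemma refl_coeff_props:
  assumes "reflection_defined chi B i" "j \<noteq> i"
  shows "refl_coeff_cond chi B i j (refl_coeff chi B i j)"
    and "s < refl_coeff chi B i j \<Longrightarrow> \<not> refl_coeff_cond chi B i j s"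
proof -
  have "\<exists>m. refl_coeff_cond chi B i j m" using assms by (simp add: reflection_defined_def)
  then show "refl_coeff_cond chi B i j (refl_coeff chi B i j)"
    unfolding refl_coeff_def by (rule LeastI_ex)
  show "s < refl_coeff chi B i j \<Longrightarrow> \<not> refl_coeff_cond chi B i j s"
    unfolding refl_coeff_def by (rule not_less_Least)
qed

lemma refl_coeff_zero:
  assumes "chi (B i) (B j) * chi (B j) (B i) = 1"
  shows "refl_coeff chi B i j = 0"
  using assms unfolding refl_coeff_def by (intro Least_equality) (auto simp: refl_coeff_cond_def)

lemma isolated_if_square_one:
  assumes "reflection_defined chi B i" "chi (B i) (B i) = 1"
  shows "isolated chi B i"
  unfolding isolated_def
proof (intro conjI allI impI assms(2))
  show "chi (B i) (B j) * chi (B j) (B i) = 1" if "j \<noteq> i" for j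
    using refl_coeff_props(1)[OF assms(1) that] assms(2) by (simp add: refl_coeff_cond_def)
qed

text \<open>\<open>chi (B l) x * chi x (B l)\<close> is multiplicative in \<open>x\<close>, so it
  stays 1 on the other new basis vectors, to which no nonzero multiple of \<open>B l\<close> has
  been added.\<close>

lemma isolated_reflection:
  assumes chi: "bicharacter chi" and B: "ordered_basis B" and l: "isolated chi B l"
  shows "isolated chi (reflection chi B i \<circ> B) l"
proof -
  note D = bicharacterD[OF chi] bicharacter_minus[OF chi] bicharacter_scale_nat[OF chi]
  let ?C = "reflection chi B i \<circ> B"
  have p: "chi (B l) (B j) * chi (B j) (B l) = 1" if "j \<noteq> l" for j
    using l that by (simp add: isolated_def)
  have Cl: "?C l = B l \<or> ?C l = - B l"
  proof (cases "l = i")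
    case False
    then have "refl_coeff chi B i l = 0"
      using p[of i] by (intro refl_coeff_zero) (auto simp: mult.commute)
    then show ?thesis using False by (simp only: reflection_apply[OF B]) simp
  qed (simp only: reflection_apply[OF B], simp)
  have inv: "inverse x * inverse y = 1" if "x * y = 1" for x y :: 'b
    using that by (metis inverse_1 inverse_mult_distrib)
  have pC: "chi (B l) (?C j) * chi (?C j) (B l) = 1" if "j \<noteq> l" for j
  proof (cases "j = i")
    case True
    then show ?thesis using inv[OF p[OF that]] by (simp only: reflection_apply[OF B]) (simp add: D)
  next
    case False
    let ?m = "refl_coeff chi B i j"
    have "(chi (B l) (B i) * chi (B i) (B l)) ^ ?m = 1"
    proof (cases "i = l")
      case True
      then have "?m = 0" using p[OF that] by (intro refl_coeff_zero) simp
      then show ?thesis by simp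
    qed (simp add: p)
    moreover have "chi (B l) (?C j) * chi (?C j) (B l) =
        (chi (B l) (B j) * chi (B j) (B l)) * (chi (B l) (B i) * chi (B i) (B l)) ^ ?m"
      using False by (simp only: reflection_apply[OF B]) (simp add: D power_mult_distrib mult_ac)
    ultimately show ?thesis using p[OF that] by simp
  qed
  have "chi (B l) (B l) = 1" using l by (simp add: isolated_def)
  with Cl pC inv[OF pC] show ?thesis
    unfolding isolated_def by (elim disjE) (simp_all add: D)
qed

text \<open>\<open>transfer\<close> concerns the scalars tested while a reflection coefficient is
  computed, up to and including its value. So \<open>chi\<close> and \<open>chi'\<close> give the
  same coefficients on every basis of the orbit.\<close>

locale torsion_specialization =
  fixes chi :: "int ^ 'n::finite \<Rightarrow> int ^ 'n \<Rightarrow> 'k::field" and E :: "'n \<Rightarrow> int ^ 'n"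
    and chi' :: "int ^ 'n \<Rightarrow> int ^ 'n \<Rightarrow> 'l::field"
  assumes chi: "bicharacter chi" and chi': "bicharacter chi'" and E: "ordered_basis E"
    and torsion: "\<And>x y. root_of_unity (chi' x y)"
    and defined: "\<And>B i. B \<in> weyl_bases chi E \<Longrightarrow> reflection_defined chi B i"
    and transfer: "\<And>B i j s. B \<in> weyl_bases chi E \<Longrightarrow> s \<le> refl_coeff chi B i j \<Longrightarrow>
      (chi' (B i) (B i) ^ s * (chi' (B i) (B j) * chi' (B j) (B i)) = 1 \<longleftrightarrow>
        chi (B i) (B i) ^ s * (chi (B i) (B j) * chi (B j) (B i)) = 1) \<and>
      (chi' (B i) (B i) ^ Suc s = 1 \<longleftrightarrow> chi (B i) (B i) ^ Suc s = 1)"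
begin

lemma highest_weight_rep_step:
  assumes B: "B \<in> weyl_bases chi E" and rel: "equal_up_to_isolated chi B B'"
    and hw: "highest_weight_rep sc chi' a b V B' e f \<Lambda> v"
  shows "\<exists>B' e f \<Lambda> v. equal_up_to_isolated chi (reflection chi B i \<circ> B) B' \<and>
    highest_weight_rep sc chi' a b V B' e f \<Lambda> v"
proof -
  note D' = bicharacterD[OF chi'] bicharacter_minus[OF chi']
  let ?C = "reflection chi B i \<circ> B" and ?m = "refl_coeff chi B i"
  have oB: "ordered_basis B" using weyl_bases_ordered_basis[OF E B] .
  note C = reflection_apply[OF oB, of chi i]
  note iso = isolated_reflection[OF chi oB]
  have rel': "B l = B' l \<or> isolated chi B l \<and> B l = - B' l" for l
    using rel by (simp add: equal_up_to_isolated_def)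
  show ?thesis
  proof (cases "chi (B i) (B i) = 1")
    case True
    \<comment> \<open>The module and \<open>B'\<close> are kept; the sign change of
      \<open>B i\<close> is absorbed by \<open>equal_up_to_isolated\<close>.\<close>
    then have i: "isolated chi B i" using isolated_if_square_one defined[OF B] by blast
    have "?C l = B' l \<or> isolated chi ?C l \<and> ?C l = - B' l" for l
    proof (cases "l = i")
      case True
      have "?C i = - B i" by (subst C) simp
      with True show ?thesis using rel'[of i] iso[OF i] by (metis minus_minus)
    next
      case False
      then have "?m l = 0" using i by (intro refl_coeff_zero) (simp add: isolated_def)
      then have "?C l = B l" using False by (subst C) simp
      then show ?thesis using rel'[of l] iso by auto
    qed
    then show ?thesis using hw unfolding equal_up_to_isolated_def by blast
  next
    case False
    then have Bi: "B i = B' i" using rel'[of i] by (auto simp: isolated_def)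
    interpret hw: highest_weight_rep sc chi' a b V B' e f \<Lambda> v by (rule hw)
    have m: "(chi' (B' i) (B' i) ^ ?m j * (chi' (B' i) (B' j) * chi' (B' j) (B' i)) = 1 \<or>
        chi' (B' i) (B' i) ^ Suc (?m j) = 1) \<and> (\<forall>s<?m j.
        chi' (B' i) (B' i) ^ s * (chi' (B' i) (B' j) * chi' (B' j) (B' i)) \<noteq> 1 \<and>
        chi' (B' i) (B' i) ^ Suc s \<noteq> 1)" if j: "j \<noteq> i" for j
    proof (cases "B j = B' j")
      case True
      have "chi (B i) (B i) ^ ?m j * (chi (B i) (B j) * chi (B j) (B i)) = 1 \<or>
        chi (B i) (B i) ^ Suc (?m j) = 1"
        using refl_coeff_props(1)[OF defined[OF B] j]
        by (auto simp: refl_coeff_cond_def mult.assoc)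
      moreover have "chi (B i) (B i) ^ s * (chi (B i) (B j) * chi (B j) (B i)) \<noteq> 1 \<and>
        chi (B i) (B i) ^ Suc s \<noteq> 1" if "s < ?m j" for s
        using refl_coeff_props(2)[OF defined[OF B] j that] False
        by (auto simp: refl_coeff_cond_def mult.assoc)
      ultimately have "chi' (B i) (B i) ^ ?m j * (chi' (B i) (B j) * chi' (B j) (B i)) = 1 \<or>
        chi' (B i) (B i) ^ Suc (?m j) = 1"
        "s < ?m j \<Longrightarrow> chi' (B i) (B i) ^ s * (chi' (B i) (B j) * chi' (B j) (B i)) \<noteq> 1 \<and>
        chi' (B i) (B i) ^ Suc s \<noteq> 1" for s
        using transfer[OF B order_refl, of i j] transfer[OF B less_imp_le, of s i j] by simp_all
      then show ?thesis unfolding Bi True by blast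
    next
      case False
      \<comment> \<open>Here the sign differs, so \<open>j\<close> is isolated. Inverting a scalar
        equal to 1 leaves it 1, so the exponent 0 is right for \<open>B'\<close> as well.\<close>
      then have l: "isolated chi B j" "B j = - B' j" using rel' by auto
      have p: "chi (B i) (B j) * chi (B j) (B i) = 1"
        using l(1) j by (simp add: isolated_def mult.commute)
      have m0: "?m j = 0" by (rule refl_coeff_zero[of chi B i j, OF p])
      have "chi' (B i) (B j) * chi' (B j) (B i) = 1"
        using transfer[OF B, of 0 i j] p by simp
      then have "inverse (chi' (B i) (B j) * chi' (B j) (B i)) = 1" by simp
      moreover have "B' j = - B j" using l(2) by simp
      ultimately have "chi' (B' i) (B' j) * chi' (B' j) (B' i) = 1"
        using Bi by (simp add: D' field_simps)
      then show ?thesis by (simp add: m0)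
    qed
    interpret step: reflection_step sc chi' a b V B' e f \<Lambda> v i ?m
    proof unfold_locales
      show "chi' (B' i) (B' i) \<noteq> 1"
        using transfer[OF B, of 0 i i] False Bi by simp
      show "\<exists>n>0. chi' (B' i) (B' i) ^ n = 1" using torsion by (simp add: root_of_unity_def)
    qed (use m in blast)+
    have "?C l = step.B' l \<or> isolated chi ?C l \<and> ?C l = - step.B' l" for l
    proof (cases "B l = B' l")
      case True
      then have "?C l = step.B' l" using Bi by (subst C) (simp add: step.B'_def)
      then show ?thesis by blast
    next
      case False
      then have l: "isolated chi B l" "B l = - B' l" "l \<noteq> i" using rel' Bi by auto
      then have "?m l = 0" by (intro refl_coeff_zero) (simp add: isolated_def mult.commute)
      then have "?C l = - step.B' l" using l by (subst C) (simp add: step.B'_def)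
      then show ?thesis using iso[OF l(1)] by blast
    qed
    then have "equal_up_to_isolated chi ?C step.B'"
      unfolding equal_up_to_isolated_def by blast
    moreover obtain \<Lambda>' v' where "highest_weight_rep sc chi' a b V step.B' step.e' step.f' \<Lambda>' v'"
      by (rule step.reflected_highest_weight_rep)
    ultimately show ?thesis by blast
  qed
qed

lemma weyl_basis_highest_weight_rep:
  assumes "B \<in> weyl_bases chi E" "highest_weight_rep sc chi' a b V E e f \<Lambda> v"
  shows "\<exists>B' e f \<Lambda> v. equal_up_to_isolated chi B B' \<and> highest_weight_rep sc chi' a b V B' e f \<Lambda> v"
  using assms(1)
proof induction
  case base
  have "equal_up_to_isolated chi E E" by (simp add: equal_up_to_isolated_def)
  then show ?case using assms(2) by blast
next
  case (step B i)
  then show ?case using highest_weight_rep_step by blast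
qed

end

lemma two_power_int_neq_one:
  assumes "c \<noteq> 0"
  shows "(2 :: 'a::field_char_0) powi c \<noteq> 1"
proof -
  have "(2::'a) ^ n \<noteq> 1" if "n > 0" for n
  proof -
    have "of_nat (2 ^ n) \<noteq> (of_nat 1 :: 'a)" unfolding of_nat_eq_iff using that by simp
    then show ?thesis by simp
  qed
  then have "(2::'a) ^ n \<noteq> 1" "inverse (2::'a) ^ n \<noteq> 1" if "n > 0" for n
    using that by (metis power_inverse inverse_1 inverse_inverse_eq)+
  then show ?thesis using assms by (cases "c \<ge> 0") (simp_all only: power_int_def if_True if_False, simp_all)
qed

lemma (in torsion_specialization) weyl_basis_positive_or_negative:
  assumes B: "B \<in> weyl_bases chi E"
    and two: "(2 :: 'l) \<noteq> 0" and char_0: "\<And>n. n \<noteq> 0 \<Longrightarrow> (2 :: 'l) powi n \<noteq> 1"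
  obtains w where "B l = word_degree E w \<or> B l = - word_degree E w"
proof -
  define c where "c x = int_vec.representation (range E) x" for x
  have ind: "int_vec.independent (range E)" and sp: "x \<in> int_vec.span (range E)" for x
    using E by (auto simp: ordered_basis_def)
  have c_add: "c (x + y) k = c x k + c y k" for x y k
    unfolding c_def by (simp add: int_vec.representation_add[OF ind sp sp])
  have "B l \<noteq> 0"
  proof
    assume "B l = 0"
    then have "(\<Sum>k\<in>UNIV. (if k = l then 1 else 0) *s B k) = 0" unfolding sum_indicator_scale by simp
    then show False
      using ordered_basis_independent_family[OF weyl_bases_ordered_basis[OF E B],
          unfolded independent_family_def, rule_format, of "\<lambda>k. if k = l then 1 else 0" l] by simp
  qed
  have "\<exists>k. c (B l) k \<noteq> 0"
  proof (rule ccontr)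
    assume "\<nexists>k. c (B l) k \<noteq> 0"
    then have "(\<Sum>v | c (B l) v \<noteq> 0. c (B l) v *s v) = 0" by simp
    then show False
      using int_vec.sum_nonzero_representation_eq[OF ind sp, of "B l"] \<open>B l \<noteq> 0\<close> by (simp add: c_def)
  qed
  then obtain k where k: "c (B l) k \<noteq> 0" by blast
  \<comment> \<open>The coordinate \<open>k\<close> of \<open>B l\<close> is nonzero, so this
    character differs from 1 on both \<open>B l\<close> and \<open>- B l\<close>. With the trivial
    character for \<open>b\<close>, the commutator then acts on \<open>v\<close> by a nonzero
    scalar.\<close>
  define a :: "int ^ 'n \<Rightarrow> 'l" where "a x = 2 powi c x k" for x

  have a: "a (x + y) = a x * a y" "a x \<noteq> 0" for x y
    using two by (simp_all add: a_def c_add power_int_add)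
  have c_minus: "c (- x) k = - c x k" for x
    using c_add[of x "- x" k] c_add[of 0 0 k] by simp
  obtain V e f v where hw: "highest_weight_rep (fun_scale :: 'l \<Rightarrow> ('n list \<Rightarrow> 'l) \<Rightarrow> 'n list \<Rightarrow> 'l) chi' a (\<lambda>_. 1) V E e f 0 v"
    by (rule highest_weight_rep_exists[OF chi' ordered_basis_independent_family[OF E] a, of "\<lambda>_. 1"]) simp_all
  then obtain B' e' f' \<Lambda>' v' where rel: "equal_up_to_isolated chi B B'"
    and hw': "highest_weight_rep fun_scale chi' a (\<lambda>_. 1) V B' e' f' \<Lambda>' v'"
    using weyl_basis_highest_weight_rep[OF B] by blast
  interpret hw: highest_weight_rep fun_scale chi' a "\<lambda>_. 1" V E e f 0 v by (rule hw)
  interpret hw': highest_weight_rep fun_scale chi' a "\<lambda>_. 1" V B' e' f' \<Lambda>' v' by (rule hw')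
  have B': "B l = B' l \<or> B l = - B' l" using rel by (auto simp: equal_up_to_isolated_def)
  then have "c (B' l) k \<noteq> 0" using k c_minus[of "B' l"] by auto
  then have "a (B' l) \<noteq> 1" unfolding a_def by (rule char_0)
  then have "hw.kw (B' l) 0 - hw.lw (B' l) 0 \<noteq> 0"
    by (simp add: hw.kw_def hw.lw_def bicharacterD[OF chi'])
  then have "fun_scale (hw.kw (B' l) 0 - hw.lw (B' l) 0) v \<noteq> 0"
    using hw.v(2) by simp
  then have "f' l v \<noteq> 0 \<or> e' l v \<noteq> 0"
    using hw'.ef[OF hw.v(1), of l] hw'.e_simps(4)[of l] hw'.f_simps(4)[of l] by auto
  then obtain w where "B' l = word_degree E w \<or> B' l = - word_degree E w"
  proof
    assume "f' l v \<noteq> 0"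
    with hw'.f_deg[OF hw.v(1), of l] obtain w where "0 - B' l = 0 - word_degree E w"
      using hw.support by blast
    then show ?thesis using that by auto
  next
    assume "e' l v \<noteq> 0"
    with hw'.e_deg[OF hw.v(1), of l] obtain w where "0 + B' l = 0 - word_degree E w"
      using hw.support by blast
    then show ?thesis using that by auto
  qed
  with B' show ?thesis using that[of w] by auto
qed

text \<open>Two span inductions, one per argument, express every value through those on
  \<open>E\<close>. Thus finitely many scalars determine a group containing all values.\<close>

lemma bicharacter_values_subgroup:
  fixes chi :: "int ^ 'n::finite \<Rightarrow> int ^ 'n \<Rightarrow> 'k::field"
  assumes chi: "bicharacter chi" and E: "ordered_basis E"
    and G: "mult_subgroup G" and EG: "\<And>i j. chi (E i) (E j) \<in> G"
  shows "chi x y \<in> G"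
proof -
  note D = bicharacterD[OF chi] bicharacter_minus[OF chi] bicharacter_scale_nat[OF chi]
  note GD = mult_subgroupD[OF G]
  have scale: "chi (c *s x) y \<in> G" "chi y (c *s x) \<in> G" if "chi x y \<in> G" "chi y x \<in> G" for c x y
  proof -
    have "c = int (nat c) \<or> c = - int (nat (- c))" by linarith
    then obtain n where "c = int n \<or> c = - int n" by blast
    then have "c *s x = int n *s x \<or> c *s x = - (int n *s x)" by auto
    then show "chi (c *s x) y \<in> G" "chi y (c *s x) \<in> G"
      using that mult_subgroup_power[OF G] GD(4) by (auto simp: D)
  qed
  have span: "z \<in> int_vec.span (range E)" for z using E by (auto simp: ordered_basis_def)
  have 1: "chi z (E j) \<in> G \<and> chi (E j) z \<in> G" for z j
    using span[of z]
  proof (induction rule: int_vec.span_induct_alt)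
    case (step c x y)
    then show ?case using EG scale[of x "E j" c] GD(3) by (auto simp: D)
  qed (simp add: D GD)
  have "chi x z \<in> G \<and> chi z x \<in> G" for z
    using span[of z]
  proof (induction rule: int_vec.span_induct_alt)
    case (step c u y)
    then show ?case using 1 scale[of u x c] GD(3) by (auto simp: D)
  qed (simp add: D GD)
  then show ?thesis by blast
qed

lemma torsion_specialization_exists:
  fixes chi :: "int ^ 'n::finite \<Rightarrow> int ^ 'n \<Rightarrow> 'k::field_char_0"
  assumes chi: "bicharacter chi" and E: "ordered_basis E" and fin: "finite (weyl_bases chi E)"
    and defined: "\<And>B i. B \<in> weyl_bases chi E \<Longrightarrow> reflection_defined chi B i"
  obtains chi' :: "int ^ 'n \<Rightarrow> int ^ 'n \<Rightarrow> 'k alg_closure" where "torsion_specialization chi E chi'"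
proof -
  define S where "S = range (\<lambda>ij. chi (E (fst ij)) (E (snd ij)))"
  have S: "chi (E i) (E j) \<in> S" for i j
    unfolding S_def by (rule range_eqI[of _ _ "(i, j)"]) simp
  have "finite S" by (simp add: S_def)
  moreover have "0 \<notin> S" using bicharacterD(1)[OF chi] unfolding S_def by fastforce
  ultimately obtain G where G: "mult_subgroup G" "S \<subseteq> G" "separated_by_torsion_chars G"
    using finite_set_in_separated_subgroup[of S] by blast
  have vals: "chi x y \<in> G" for x y
    by (rule bicharacter_values_subgroup[OF chi E G(1)]) (use S G(2) in blast)
  \<comment> \<open>All scalars compared with 1 in \<open>transfer\<close>; finitely many, since
    there are finitely many bases and each coefficient bounds \<open>s\<close>. Keeping those other
    than 1 nontrivial preserves every comparison.\<close>
  define relevant where "relevant = (\<Union>B\<in>weyl_bases chi E. \<Union>i. \<Union>j. \<Union>s\<in>{..refl_coeff chi B i j}.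
    {chi (B i) (B i) ^ s * (chi (B i) (B j) * chi (B j) (B i)), chi (B i) (B i) ^ Suc s})"
  have sub: "relevant \<subseteq> G"
    unfolding relevant_def using vals mult_subgroup_power[OF G(1)] mult_subgroupD(3)[OF G(1)]
    by (auto simp del: power_Suc)
  have "finite (relevant - {1})"
    unfolding relevant_def using fin by auto
  then obtain \<phi> :: "'k \<Rightarrow> 'k alg_closure" where \<phi>: "torsion_char G \<phi>" "1 \<notin> \<phi> ` (relevant - {1})"
    using G(3)[unfolded separated_by_torsion_chars_def, rule_format, of "relevant - {1}"] sub by blast
  have mult: "\<phi> (x * y) = \<phi> x * \<phi> y" if "x \<in> G" "y \<in> G" for x y
    using \<phi>(1) that by (simp add: torsion_char_def)
  have tors: "root_of_unity (\<phi> x)" if "x \<in> G" for x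
    using \<phi>(1) that by (simp add: torsion_char_def)
  have one: "\<phi> x = 1 \<longleftrightarrow> x = 1" if "x \<in> relevant" for x
    using \<phi>(2) that torsion_char_one[OF \<phi>(1) G(1)] by (metis Diff_iff image_eqI singletonD)
  define chi' where "chi' x y = \<phi> (chi x y)" for x y
  have "torsion_specialization chi E chi'"
  proof unfold_locales
    show "bicharacter chi'"
      using chi mult vals root_of_unity_nonzero[OF tors[OF vals]] torsion_char_one[OF \<phi>(1) G(1)]
      by (simp add: bicharacter_def chi'_def)
    fix B i j s assume B: "B \<in> weyl_bases chi E" and s: "s \<le> refl_coeff chi B i j"
    have "chi (B i) (B i) ^ s * (chi (B i) (B j) * chi (B j) (B i)) \<in> relevant"
      "chi (B i) (B i) ^ Suc s \<in> relevant"
      using B s unfolding relevant_def by blast+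
    from this[THEN one] show "(chi' (B i) (B i) ^ s * (chi' (B i) (B j) * chi' (B j) (B i)) = 1 \<longleftrightarrow>
        chi (B i) (B i) ^ s * (chi (B i) (B j) * chi (B j) (B i)) = 1) \<and>
      (chi' (B i) (B i) ^ Suc s = 1 \<longleftrightarrow> chi (B i) (B i) ^ Suc s = 1)"
      using mult vals mult_subgroup_power[OF G(1)] mult_subgroupD(3)[OF G(1)]
        torsion_char_power[OF \<phi>(1) G(1) vals]
      by (simp add: chi'_def del: power_Suc)
  qed (use chi E defined tors vals in \<open>auto simp: chi'_def\<close>)
  then show ?thesis using that by blast
qed

theorem corollary1:
  fixes chi :: "int ^ 'n \<Rightarrow> int ^ 'n \<Rightarrow> 'k::field_char_0"
    and E :: "'n \<Rightarrow> int ^ 'n"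
    and \<Delta> :: "(int ^ 'n) set"
  assumes "bicharacter chi"
    and "ordered_basis E"
    and "arithmetic_root_system \<Delta> chi E"
  shows "\<Delta> = positive_roots \<Delta> E \<union> uminus ` positive_roots \<Delta> E"
proof -
  let ?R = "weyl_bases chi E"
  have R: "(id, B) \<in> weyl_groupoid chi E \<longleftrightarrow> B \<in> ?R" for B
    unfolding weyl_groupoid_eq[OF assms(2)] by (simp add: arrows_on_def lattice_aut_id)
  have fin: "finite ?R"
  proof (rule finite_subset)
    show "?R \<subseteq> snd ` weyl_groupoid chi E" using R by force
    show "finite (snd ` weyl_groupoid chi E)"
      using assms(3) by (simp add: arithmetic_root_system_def)
  qed
  have defined: "reflection_defined chi B i" if "B \<in> ?R" for B i
    using assms(3) that R by (auto simp: arithmetic_root_system_def)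
  have \<Delta>: "\<Delta> = (\<Union>B\<in>?R. range B)"
    using assms(3) R by (simp add: arithmetic_root_system_def)
  \<comment> \<open>Every root is a member of some basis of the orbit, and reflecting that basis at
    its index negates it.\<close>
  have neg: "- x \<in> \<Delta>" if "x \<in> \<Delta>" for x
  proof -
    have "x \<in> (\<Union>B\<in>?R. range B)" using that \<Delta> by simp
    then obtain B i where B: "B \<in> ?R" "x = B i" by blast
    have "(reflection chi B i \<circ> B) i = - x"
      unfolding reflection_apply[OF weyl_bases_ordered_basis[OF assms(2) B(1)]] using B(2) by simp
    then have "- x \<in> (\<Union>B\<in>?R. range B)"
      using weyl_bases.step[OF B(1) defined[OF B(1)], of i] by (metis UN_I rangeI)
    then show ?thesis using \<Delta> by simp
  qed
  obtain chi' :: "int ^ 'n \<Rightarrow> int ^ 'n \<Rightarrow> 'k alg_closure" where "torsion_specialization chi E chi'"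
    using torsion_specialization_exists[OF assms(1,2) fin defined] by blast
  then interpret torsion_specialization chi E chi' .
  have pos: "x \<in> positive_roots \<Delta> E" if "x \<in> \<Delta>" "x = word_degree E w" for x w
    using that unfolding positive_roots_def word_degree_eq_sum by blast
  have "x \<in> positive_roots \<Delta> E \<union> uminus ` positive_roots \<Delta> E" if x: "x \<in> \<Delta>" for x
  proof -
    have "x \<in> (\<Union>B\<in>?R. range B)" using x \<Delta> by simp
    then obtain B l where B: "B \<in> ?R" "x = B l" by blast
    obtain w where "x = word_degree E w \<or> x = - word_degree E w"
      using weyl_basis_positive_or_negative[OF B(1) _ two_power_int_neq_one, of l] B(2) by auto
    then show ?thesis
    proof
      assume "x = - word_degree E w"
      then have "- x \<in> positive_roots \<Delta> E" using pos[OF neg[OF x]] by simp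
      then show ?thesis by (metis UnI2 image_eqI minus_minus)
    qed (use pos x in blast)
  qed
  moreover have "positive_roots \<Delta> E \<union> uminus ` positive_roots \<Delta> E \<subseteq> \<Delta>"
    using neg by (auto simp: positive_roots_def)
  ultimately show ?thesis by blast
qed

end
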